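(* Let $p\ge 3$ be a prime and $r\ge p(2p+1)$. Write $r=p^{n}u$ with $p\nmid u$. Set $\delta=1$ if $n\ge 2$ or $\Sigma_p(r-p)>\Sigma_p(r-1)$, and $\delta=0$ otherwise. Then $$\dim X_{r-p,\,r}=\begin{cases}2\,\Sigma_p(r)+\delta\,(p+2-\Sigma_p(r)), & \text{if } \Sigma_p(r)\le p,\\ 2p+2, & \text{if } \Sigma_p(r)>p.\end{cases}$$
   Context: Let $\Gamma=\mathrm{GL}_2(\mathbb{F}_p)$. $V_r$ is the $\mathbb{F}_p$-space of homogeneous polynomials $F(X,Y)$ of degree $r$ over $\mathbb{F}_p$, with action $\begin{pmatrix} a&b\\c&d\end{pmatrix}\cdot F(X,Y)=F(aX+cY,\,bX+dY)$ for $\begin{pmatrix} a&b\\c&d\end{pmatrix}\in\Gamma$. $X_{r-p,\,r}\subseteq V_r$ is the $\mathbb{F}_p[\Gamma]$-submodule generated by the monomial $X^{r-p}Y^{p}$; $\dim$ is dimension over $\mathbb{F}_p$. $\Sigma_p(n)$ is the sum of the digits of the base $p$-expansion of $n\ge0$. *)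

theory Defs
  imports "HOL-Analysis.Analysis" "HOL-Computational_Algebra.Polynomial"
begin

text \<open>
  Polynomials in \<open>X\<close>, \<open>Y\<close> over \<open>'k\<close> are elements of \<open>'k poly poly\<close>: the outer variable is \<open>Y\<close>, the
  coefficients are polynomials in \<open>X\<close>. So \<open>coeff (coeff F j) i\<close> is the coefficient of \<open>X^i Y^j\<close>.
\<close>

abbreviation const_poly :: "'k::field \<Rightarrow> 'k poly poly"
  where "const_poly a \<equiv> [:[:a:]:]"

definition varX :: "'k::field poly poly"
  where "varX = [:[:0, 1:]:]"

definition varY :: "'k::field poly poly"
  where "varY = [:0, 1:]"

definition subst_XY :: "'k::field poly poly \<Rightarrow> 'k poly poly \<Rightarrow> 'k poly poly \<Rightarrow> 'k poly poly"
  where "subst_XY F P Q = poly (map_poly (\<lambda>f. poly (map_poly const_poly f) P) F) Q"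

definition homogeneous :: "nat \<Rightarrow> 'k::field poly poly set"
  where "homogeneous r = {F. \<forall>i j. coeff (coeff F j) i \<noteq> 0 \<longrightarrow> i + j = r}"

definition scale_XY :: "'k::field \<Rightarrow> 'k poly poly \<Rightarrow> 'k poly poly"
  where "scale_XY c F = smult [:c:] F"

global_interpretation poly_XY: vector_space "scale_XY :: 'k::field \<Rightarrow> 'k poly poly \<Rightarrow> 'k poly poly"
  by unfold_locales
    (simp_all add: scale_XY_def smult_add_right mult.commute flip: smult_add_left one_pCons)

definition gl2_act :: "'k::field ^ 2 ^ 2 \<Rightarrow> 'k poly poly \<Rightarrow> 'k poly poly"
  where "gl2_act A F =
    subst_XY F (scale_XY (A $ 1 $ 1) varX + scale_XY (A $ 2 $ 1) varY)
               (scale_XY (A $ 1 $ 2) varX + scale_XY (A $ 2 $ 2) varY)"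

definition gl2_submodule :: "nat \<Rightarrow> 'k::field poly poly set \<Rightarrow> bool"
  where "gl2_submodule r W \<longleftrightarrow>
    W \<subseteq> homogeneous r \<and> poly_XY.subspace W \<and>
    (\<forall>A F. invertible A \<longrightarrow> F \<in> W \<longrightarrow> gl2_act A F \<in> W)"

definition generated_submodule :: "nat \<Rightarrow> 'k::field poly poly \<Rightarrow> 'k poly poly set"
  where "generated_submodule r F = gl2_submodule r hull {F}"

text \<open>The guard \<open>p < 2\<close> only ensures termination; bases below 2 are not used.\<close>

fun digit_sum :: "nat \<Rightarrow> nat \<Rightarrow> nat"
  where "digit_sum p n = (if n = 0 \<or> p < 2 then 0 else n mod p + digit_sum p (n div p))"

declare digit_sum.simps [simp del]

end

theory Submission
  imports Defs "HOL-Number_Theory.Cong"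
begin

text \<open>
  Put \<open>s = r - p\<close>. Over \<open>F_p\<close> the \<open>p\<close>-th power is additive, so the module is spanned by the
  products \<open>L^s X^p\<close> and \<open>L^s Y^p\<close> with \<open>L\<close> a linear form (\<open>generated_submodule_eq_span\<close>).
  Averaging \<open>(X + tY)^s\<close> over \<open>t\<close> against powers of \<open>t\<close> isolates the monomials whose
  \<open>Y\<close>-exponent lies in a given class modulo \<open>p - 1\<close>. Hence the module is the direct sum of the
  four lines through \<open>X^r\<close>, \<open>X^s Y^p\<close>, \<open>X^p Y^s\<close>, \<open>Y^r\<close> and, for each class \<open>b\<close>, of the span of
  two vectors with coefficients \<open>C(s, j)\<close> and \<open>C(s, j - p)\<close>, where \<open>j\<close> runs through the other
  exponents in the class (\<open>span_power_products_eq\<close>). What remains is to find the rank, 0, 1 or 2,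
  of each of these pairs, and to add the ranks (\<open>dim_module_eq\<close>).

  By Lucas' theorem the classes of those \<open>j\<close> strictly between \<open>0\<close> and \<open>n\<close> for which \<open>p\<close> does not
  divide \<open>C(n, j)\<close> are the classes of \<open>1, ..., D - 1\<close>, where \<open>D\<close> is the digit sum of \<open>n\<close>
  (\<open>residues_eq\<close>). Let \<open>s1\<close> be the digit of \<open>s\<close> at \<open>p\<close>; two cases arise when \<open>p\<close> is added to \<open>s\<close>.

  If \<open>s1 < p - 1\<close>, there is no carry, and the two vectors of a class are independent as soon as
  both are nonzero: in a relation one may change the exponent within its class so that either
  only one coefficient survives, or two proportions between neighbouring binomial coefficients
  \<open>C(s1, A - 1), C(s1, A), C(s1, A + 1)\<close> contradict each other (\<open>first_coefficient_eq_0\<close>). Each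
  vector then contributes one residue class of \<open>s\<close>, and the dimension is
  \<open>4 + 2 min(p - 1, D(s) - 1)\<close> with \<open>D(s) = D(r) - 1\<close> (\<open>dim_no_carry\<close>).

  If \<open>s1 = p - 1\<close>, the first vector of every class is nonzero, and one replaces the second by the
  sum of both, whose coefficients are \<open>C(r, j)\<close> because \<open>(X + Y)^r = (X + Y)^s (X^p + Y^p)\<close>. Since
  \<open>r\<close> has digit \<open>0\<close> at \<open>p\<close>, the sum vanishes at every \<open>j\<close> with a nonzero digit there, whereas the
  first vector does not, except possibly for \<open>b = 1\<close>, a class that needs separate treatment; the two
  are thus independent whenever the sum is nonzero (\<open>coefficients_eq_0_carry\<close>), so the dimension is \<open>4 + (p - 1) + min(p - 1, D(r) - 1)\<close>
  (\<open>dim_carry\<close>). Finally, \<open>\<delta> = 1\<close> says exactly that the carry occurs (\<open>carry_iff\<close>).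
\<close>

section \<open>Fields of prime cardinality\<close>

text \<open>
  The dummy parameter \<open>ty\<close> lets the locale speak about the cardinality of a type.
\<close>

locale prime_field =
  fixes p :: nat and ty :: "'k::field itself"
  assumes prime_p: "prime p" and card_k: "CARD('k) = p"
begin

lemma p_gt_1: "p > 1"
  using prime_p by (rule prime_gt_1_nat)

lemma finite_k: "finite (UNIV :: 'k set)"
  using card_k p_gt_1 by (metis card.infinite not_one_less_zero)

lemma CHAR_k: "CHAR('k) = p"
proof -
  have "(\<Sum>x\<in>(UNIV::'k set). x + 1) = (\<Sum>x\<in>UNIV. x)"
    by (rule sum.reindex_bij_witness[of _ "\<lambda>x. x - 1" "\<lambda>x. x + 1"]) auto
  hence "of_nat p = (0::'k)"
    by (simp add: sum.distrib card_k)
  hence "CHAR('k) dvd p"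
    by (simp add: of_nat_eq_0_iff_char_dvd)
  thus ?thesis
    using prime_p CHAR_not_1[where ?'a = 'k] by (auto simp: prime_nat_iff)
qed

lemma of_nat_k_eq_0_iff: "of_nat n = (0::'k) \<longleftrightarrow> p dvd n"
  by (simp add: of_nat_eq_0_iff_char_dvd CHAR_k)

lemma power_card_minus_1:
  fixes x :: 'k
  assumes "x \<noteq> 0"
  shows "x ^ (p - 1) = 1"
proof -
  have "(\<Prod>y\<in>UNIV-{0}. x * y) = (\<Prod>y\<in>UNIV-{0}. y)"
    by (rule prod.reindex_bij_witness[of _ "\<lambda>y. y / x" "\<lambda>y. x * y"]) (use assms in auto)
  hence "x ^ (p - 1) * \<Prod>(UNIV - {0}) = \<Prod>(UNIV - {0})"
    by (simp add: prod.distrib card_Diff_singleton finite_k card_k)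
  moreover have "\<Prod>(UNIV - {0::'k}) \<noteq> 0"
    by (simp add: finite_k)
  ultimately show ?thesis
    by simp
qed

lemma power_p: "(x::'k) ^ p = x"
  using power_card_minus_1[of x] p_gt_1 by (cases "x = 0") (auto simp: power_eq_if)

text \<open>
  Both exponents are required to be positive so that the equation also holds at \<open>x = 0\<close>.
\<close>

lemma power_cong:
  fixes x :: 'k
  assumes "[i = j] (mod (p - 1))" and "i > 0" and "j > 0"
  shows "x ^ i = x ^ j"
proof (cases "x = 0")
  case False
  have "x ^ m = x ^ (m mod (p - 1))" for m
  proof -
    have "x ^ m = x ^ ((p - 1) * (m div (p - 1)) + m mod (p - 1))"
      by simp
    also have "\<dots> = x ^ (m mod (p - 1))"
      unfolding power_add power_mult power_card_minus_1[OF False] by simp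
    finally show ?thesis .
  qed
  thus ?thesis
    using assms(1) by (metis cong_def)
qed (use assms in \<open>simp add: power_0_left\<close>)

text \<open>
  If \<open>a ^ j\<close> differs from \<open>1\<close>, the substitution of \<open>a x\<close> for \<open>x\<close> multiplies the sum by \<open>a ^ j\<close>, so it
  vanishes; such an \<open>a\<close> exists because a polynomial \<open>x ^ m - 1\<close> with \<open>0 < m < p - 1\<close> has too few roots.
  These sums act as a filter for exponents divisible by \<open>p - 1\<close>.
\<close>

lemma sum_powers:
  assumes "j > 0"
  shows "(\<Sum>x\<in>UNIV. (x::'k) ^ j) = (if (p - 1) dvd j then -1 else 0)"
proof (cases "(p - 1) dvd j")
  case True
  then obtain m where m: "j = (p - 1) * m" ..
  have "(\<Sum>x\<in>UNIV. (x::'k) ^ j) = (\<Sum>x\<in>UNIV-{0}. x ^ j)"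
    by (rule sum.mono_neutral_right) (use assms finite_k in auto)
  also have "\<dots> = (\<Sum>x\<in>UNIV-{0::'k}. 1)"
    by (rule sum.cong) (simp_all add: m power_mult power_card_minus_1 del: One_nat_def)
  also have "\<dots> = of_nat (p - 1)"
    by (simp add: card_Diff_singleton finite_k card_k)
  also have "\<dots> = (-1::'k)"
    using of_nat_k_eq_0_iff[of p] p_gt_1 by (simp add: of_nat_diff)
  finally show ?thesis
    using True by simp
next
  case False
  define m where "m = j mod (p - 1)"
  have m: "m > 0" "m < p - 1" "[m = j] (mod (p - 1))"
    using False p_gt_1 by (auto simp: m_def dvd_eq_mod_eq_0)
  have "\<exists>a::'k. a \<noteq> 0 \<and> a ^ m \<noteq> 1"
  proof (rule ccontr)
    assume *: "\<not> ?thesis"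
    define P :: "'k poly" where "P = monom 1 m - 1"
    have deg: "degree P \<le> m"
      unfolding P_def by (intro degree_diff_le) (auto simp: degree_monom_eq)
    have "coeff P m = 1"
      using m by (simp add: P_def)
    hence nz: "P \<noteq> 0" by auto
    have "card (UNIV - {0::'k}) \<le> card {x. poly P x = 0}"
      by (rule card_mono) (use * finite_k in \<open>auto simp: P_def poly_monom intro: finite_subset\<close>)
    also have "\<dots> \<le> m"
      using card_poly_roots_bound[OF nz] deg by linarith
    finally show False
      using m by (simp add: card_Diff_singleton finite_k card_k)
  qed
  then obtain a :: 'k where a: "a \<noteq> 0" "a ^ m \<noteq> 1" by blast
  have "a ^ j \<noteq> 1"
    using power_cong[OF m(3) m(1) assms] a by simp
  have "(\<Sum>x\<in>UNIV. (x::'k) ^ j) = (\<Sum>x\<in>UNIV. (a * x) ^ j)"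
    by (rule sum.reindex_bij_witness[of _ "\<lambda>x. a * x" "\<lambda>x. x / a"]) (use a in auto)
  also have "\<dots> = a ^ j * (\<Sum>x\<in>UNIV. x ^ j)"
    by (simp add: power_mult_distrib sum_distrib_left)
  finally have "(a ^ j - 1) * (\<Sum>x\<in>UNIV. (x::'k) ^ j) = 0"
    by (simp add: algebra_simps)
  thus ?thesis
    using \<open>a ^ j \<noteq> 1\<close> False by simp
qed

section \<open>Binomial coefficients modulo p and digit sums\<close>

definition bin :: "nat \<Rightarrow> nat \<Rightarrow> 'k"
  where "bin n j = of_nat (n choose j)"

lemma bin_0_right [simp]: "bin n 0 = 1" and bin_refl [simp]: "bin n n = 1"
  by (simp_all add: bin_def)

lemma bin_eq_0: "n < j \<Longrightarrow> bin n j = 0"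
  by (simp add: bin_def binomial_eq_0)

lemma bin_symmetric: "j \<le> n \<Longrightarrow> bin n (n - j) = bin n j"
  by (simp add: bin_def binomial_symmetric[symmetric])

lemma bin_1_right: "bin n (Suc 0) = of_nat n"
  by (simp add: bin_def)

lemma bin_small_neq_0:
  assumes "n < p" "j \<le> n"
  shows "bin n j \<noteq> 0"
proof
  assume "bin n j = 0"
  hence "p dvd (n choose j)"
    by (simp add: bin_def of_nat_k_eq_0_iff)
  hence "p dvd fact n"
    using binomial_fact_lemma[OF assms(2)] by (metis dvd_mult)
  thus False
    using assms(1) prime_p by (simp add: prime_dvd_fact_iff)
qed

text \<open>
  This is the comparison of coefficients in \<open>(1 + T)^(n + p) = (1 + T)^n (1 + T^p)\<close>.
\<close>

lemma bin_add_p: "bin (n + p) j = bin n j + (if p \<le> j then bin n (j - p) else 0)"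
proof -
  have vanish: "bin p k = 0" if "k \<noteq> 0" "k \<noteq> p" for k
  proof (cases "k < p")
    case True
    thus ?thesis
      using that prime_p by (auto simp: bin_def of_nat_k_eq_0_iff intro: dvd_choose_prime)
  next
    case False
    with that show ?thesis by (intro bin_eq_0) auto
  qed
  have "bin (n + p) j = (\<Sum>k\<le>j. bin p k * bin n (j - k))"
    using vandermonde[of p n j] unfolding bin_def
    by (simp add: add.commute flip: of_nat_mult of_nat_sum)
  also have "\<dots> = (\<Sum>k\<in>(if p \<le> j then {0, p} else {0}). bin p k * bin n (j - k))"
    by (rule sum.mono_neutral_right) (use vanish in \<open>auto split: if_splits\<close>)
  also have "\<dots> = bin n j + (if p \<le> j then bin n (j - p) else 0)"
    using p_gt_1 by auto
  finally show ?thesis .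
qed

text \<open>
  One digit of Lucas' theorem, by adding \<open>p\<close> to the upper argument \<open>n\<close> times.
\<close>

lemma lucas_step:
  assumes "n0 < p" and "j0 < p"
  shows "bin (n0 + p * n) (j0 + p * j) = bin n0 j0 * bin n j"
proof (induction n arbitrary: j)
  case 0
  show ?case
  proof (cases "j = 0")
    case False
    hence "p * 1 \<le> p * j"
      by (intro mult_le_mono) auto
    hence "n0 < j0 + p * j"
      using assms by linarith
    thus ?thesis
      using False by (simp add: bin_eq_0)
  qed simp
next
  case (Suc n)
  have "bin (n0 + p * Suc n) (j0 + p * j) = bin ((n0 + p * n) + p) (j0 + p * j)"
    by (simp add: algebra_simps)
  also have "\<dots> = bin n0 j0 * bin (Suc n) j"
  proof (cases j)
    case 0
    thus ?thesis
      using Suc[of 0] assms by (simp add: bin_add_p)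
  next
    case (Suc i)
    have "j0 + p * j - p = j0 + p * i" "p \<le> j0 + p * j"
      using Suc by (simp_all add: algebra_simps)
    hence "bin ((n0 + p * n) + p) (j0 + p * j) = bin n0 j0 * (bin n j + bin n i)"
      by (simp only: bin_add_p if_True Suc.IH distrib_left)
    also have "bin n j + bin n i = bin (Suc n) j"
      by (simp add: Suc bin_def)
    finally show ?thesis .
  qed
  finally show ?case .
qed

lemma digit_sum_0 [simp]: "digit_sum p 0 = 0"
  by (simp add: digit_sum.simps)

lemma digit_sum_step: "n0 < p \<Longrightarrow> digit_sum p (n0 + p * n) = n0 + digit_sum p n"
  using p_gt_1 by (cases "n0 + p * n = 0") (auto simp: digit_sum.simps[of p "n0 + p * n"])

lemma last_digit_induct [case_names zero step]:
  assumes "P 0" and "\<And>n0 n. n0 < p \<Longrightarrow> n0 + p * n > 0 \<Longrightarrow> P n \<Longrightarrow> P (n0 + p * n)"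
  shows "P n"
proof (induction n rule: less_induct)
  case (less n)
  show ?case
  proof (cases "n = 0")
    case False
    have "n div p < n"
      using False p_gt_1 by simp
    hence "P (n mod p + p * (n div p))"
      using p_gt_1 False by (intro assms(2) less) auto
    thus ?thesis by simp
  qed (use assms in simp)
qed

lemma digit_sum_eq_0_iff: "digit_sum p n = 0 \<longleftrightarrow> n = 0"
proof (induction n rule: last_digit_induct)
  case (step n0 n)
  thus ?case using p_gt_1 by (auto simp: digit_sum_step)
qed simp

lemma digit_sum_cong: "[digit_sum p n = n] (mod (p - 1))"
proof (induction n rule: last_digit_induct)
  case (step n0 n)
  have "[n0 + digit_sum p n = n0 + 1 * n] (mod (p - 1))"
    using step by (intro cong_add) (simp_all del: One_nat_def)
  also have "[n0 + 1 * n = n0 + p * n] (mod (p - 1))"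
  proof (intro cong_add cong_mult cong_refl)
    have "[1 = 1 + (p - 1)] (mod (p - 1))"
      by (simp add: cong_def del: One_nat_def)
    thus "[1 = p] (mod (p - 1))"
      using p_gt_1 by simp
  qed
  finally show ?case
    using step by (simp add: digit_sum_step)
qed simp

lemma digit_sum_Suc_le: "digit_sum p (Suc n) \<le> Suc (digit_sum p n)"
proof (induction n rule: last_digit_induct)
  case zero
  show ?case using digit_sum_step[of 1 0] p_gt_1 by simp
next
  case (step n0 n)
  show ?case
  proof (cases "Suc n0 < p")
    case True
    thus ?thesis
      using digit_sum_step[of "Suc n0" n] step by (simp add: digit_sum_step)
  next
    case False
    hence eq: "Suc (n0 + p * n) = 0 + p * Suc n"
      using step by simp
    have "digit_sum p (Suc (n0 + p * n)) = digit_sum p (Suc n)"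
      unfolding eq using digit_sum_step[of 0 "Suc n"] p_gt_1 by simp
    thus ?thesis
      using step by (simp add: digit_sum_step)
  qed
qed

text \<open>
  By Lucas' theorem each digit of \<open>j\<close> is at most the corresponding digit of \<open>n\<close>, so the subtraction
  \<open>n - j\<close> proceeds without borrowing.
\<close>

lemma digit_sum_add_of_bin_neq_0:
  "bin n j \<noteq> 0 \<Longrightarrow> digit_sum p j + digit_sum p (n - j) = digit_sum p n"
proof (induction n arbitrary: j rule: last_digit_induct)
  case zero
  thus ?case by (cases "j = 0") (auto simp: bin_eq_0)
next
  case (step n0 n)
  define j0 j' where "j0 = j mod p" and "j' = j div p"
  have j: "j = j0 + p * j'" "j0 < p"
    using p_gt_1 by (auto simp: j0_def j'_def)
  have "bin n0 j0 * bin n j' \<noteq> 0"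
    using step.prems lucas_step[OF step.hyps(1) j(2)] by (simp add: j)
  hence nz: "j0 \<le> n0" "j' \<le> n" "bin n j' \<noteq> 0"
    using bin_eq_0 by (force simp: not_less[symmetric])+
  have "n0 + p * n - j = (n0 - j0) + p * (n - j')"
    using nz by (simp add: j algebra_simps)
  hence "digit_sum p (n0 + p * n - j) = (n0 - j0) + digit_sum p (n - j')"
    using digit_sum_step[of "n0 - j0" "n - j'"] step.hyps by simp
  thus ?case
    using step.IH[OF nz(3)] nz step.hyps j by (simp add: digit_sum_step)
qed

text \<open>
  Fill up the digits of \<open>n\<close> from the lowest one until the total \<open>\<sigma>\<close> is reached.
\<close>

lemma ex_bin_neq_0_digit_sum:
  assumes "\<sigma> \<le> digit_sum p n"
  shows "\<exists>j. bin n j \<noteq> 0 \<and> digit_sum p j = \<sigma>"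
  using assms
proof (induction n arbitrary: \<sigma> rule: last_digit_induct)
  case zero
  thus ?case by (auto intro: exI[of _ 0])
next
  case (step n0 n)
  show ?case
  proof (cases "\<sigma> \<le> n0")
    case True
    have "bin (n0 + p * n) (\<sigma> + p * 0) \<noteq> 0"
      using True step.hyps by (subst lucas_step) (auto simp: bin_small_neq_0)
    moreover have "digit_sum p (\<sigma> + p * 0) = \<sigma>"
      using True step.hyps by (subst digit_sum_step) auto
    ultimately show ?thesis by blast
  next
    case False
    hence "\<sigma> - n0 \<le> digit_sum p n"
      using step.prems step.hyps by (simp add: digit_sum_step)
    then obtain j where j: "bin n j \<noteq> 0" "digit_sum p j = \<sigma> - n0"
      using step.IH by blast
    have "bin (n0 + p * n) (n0 + p * j) \<noteq> 0"
      using j step.hyps by (subst lucas_step) auto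
    moreover have "digit_sum p (n0 + p * j) = \<sigma>"
      using False j step.hyps by (subst digit_sum_step) auto
    ultimately show ?thesis by blast
  qed
qed

text \<open>
  The classes modulo \<open>p - 1\<close> of the exponents of the inner monomials of \<open>(X + Y)^n\<close>. Classes
  are represented by \<open>1, ..., p - 1\<close> rather than \<open>0, ..., p - 2\<close>: a positive exponent \<open>j\<close> in the class
  of \<open>b\<close> then satisfies \<open>t ^ j = t ^ b\<close> for \<open>t = 0\<close> too.
\<close>

definition residues :: "nat \<Rightarrow> nat set"
  where "residues n = {b\<in>{1..p-1}. \<exists>j. 0 < j \<and> j < n \<and> [j = b] (mod (p - 1)) \<and> bin n j \<noteq> 0}"

lemma cong_imp_eq_or_larger:
  assumes "[\<sigma> = b] (mod (p - 1))" "0 < \<sigma>" "1 \<le> b" "b \<le> p - 1"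
  shows "b \<le> \<sigma>"
proof -
  have "b - 1 = (b - 1) mod (p - 1)"
    using assms by simp
  also have "\<dots> = (\<sigma> - 1) mod (p - 1)"
  proof -
    have "[(\<sigma> - 1) + 1 = (b - 1) + 1] (mod (p - 1))"
      using assms by simp
    hence "[\<sigma> - 1 = b - 1] (mod (p - 1))"
      by (simp only: cong_add_rcancel_nat)
    thus ?thesis
      by (simp add: cong_def)
  qed
  also have "\<dots> \<le> \<sigma> - 1"
    by simp
  finally show ?thesis
    using assms by linarith
qed

lemma ex_positive_residue: "\<exists>b\<in>{1..p-1}. [i = b] (mod (p - 1))"
proof (cases "(p - 1) dvd i")
  case True
  hence "[i = p - 1] (mod (p - 1))"
    by (simp add: cong_def)
  thus ?thesis
    using p_gt_1 by (intro bexI[of _ "p - 1"]) auto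
next
  case False
  hence "i mod (p - 1) > 0" "i mod (p - 1) < p - 1"
    using p_gt_1 by (auto simp: mod_greater_zero_iff_not_dvd)
  thus ?thesis
    by (intro bexI[of _ "i mod (p - 1)"]) (simp_all add: cong_def)
qed

text \<open>
  A digit sum is congruent to its number modulo \<open>p - 1\<close>, and the digit sums of the \<open>j\<close> with
  nonvanishing \<open>C(n, j)\<close> are all the numbers up to that of \<open>n\<close>, the two extreme ones
  being attained only at \<open>j = 0\<close> and \<open>j = n\<close>.
\<close>

lemma residues_eq: "residues n = {1..min (p - 1) (digit_sum p n - 1)}"
proof (intro set_eqI iffI)
  fix b assume "b \<in> residues n"
  then obtain j where b: "b \<in> {1..p-1}"
    and j: "0 < j" "j < n" "[j = b] (mod (p - 1))" "bin n j \<noteq> 0"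
    by (auto simp: residues_def)
  have "[digit_sum p j = b] (mod (p - 1))"
    using digit_sum_cong j(3) by (rule cong_trans)
  moreover have "digit_sum p j > 0" "digit_sum p (n - j) > 0"
    using j digit_sum_eq_0_iff[of j] digit_sum_eq_0_iff[of "n - j"] by auto
  ultimately have "b \<le> digit_sum p j" "digit_sum p j < digit_sum p n"
    using cong_imp_eq_or_larger b digit_sum_add_of_bin_neq_0[OF j(4)] by auto
  thus "b \<in> {1..min (p - 1) (digit_sum p n - 1)}"
    using b by auto
next
  fix b assume b: "b \<in> {1..min (p - 1) (digit_sum p n - 1)}"
  hence "b \<le> digit_sum p n"
    by auto
  then obtain j where j: "bin n j \<noteq> 0" "digit_sum p j = b"
    using ex_bin_neq_0_digit_sum by blast
  have "j \<noteq> 0" using j b digit_sum_eq_0_iff[of j] by auto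
  moreover have "j \<noteq> n" using j b by auto
  moreover have "j \<le> n" using j bin_eq_0[of n j] by force
  moreover have "[j = b] (mod (p - 1))"
    using digit_sum_cong[of j] j by (simp add: cong_sym_eq)
  ultimately show "b \<in> residues n"
    using b j by (auto simp: residues_def)
qed

lemma card_residues: "card (residues n) = min (p - 1) (digit_sum p n - 1)"
  by (simp add: residues_eq)

end

section \<open>The action by linear substitutions\<close>

lemma map_poly_hom_add:
  assumes "h 0 = 0" "\<And>x y. h (x + y) = h x + h y"
  shows "map_poly h (F + G) = map_poly h F + map_poly h G"
  by (rule poly_eqI) (simp add: coeff_map_poly assms)

lemma map_poly_hom_mult:
  fixes h :: "'a::comm_ring_1 \<Rightarrow> 'b::comm_ring_1"
  assumes "h 0 = 0" "\<And>x y. h (x + y) = h x + h y" "\<And>x y. h (x * y) = h x * h y"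
  shows "map_poly h (F * G) = map_poly h F * map_poly h G"
proof -
  have "h (sum g A) = (\<Sum>x\<in>A. h (g x))" for g :: "nat \<Rightarrow> 'a" and A
    by (induction A rule: infinite_finite_induct) (simp_all add: assms)
  thus ?thesis
    by (intro poly_eqI) (simp add: coeff_map_poly coeff_mult assms)
qed

text \<open>
  Substitution is a homomorphism of \<open>'k\<close>-algebras, so the action on a product of linear forms is
  determined by the action on linear forms.
\<close>

lemma subst_XY_add: "subst_XY (F + G) P Q = subst_XY F P Q + subst_XY G P Q"
  unfolding subst_XY_def by (simp add: map_poly_hom_add)

lemma subst_XY_mult: "subst_XY (F * G) P Q = subst_XY F P Q * subst_XY G P Q"
  unfolding subst_XY_def by (simp add: map_poly_hom_add map_poly_hom_mult)

lemma subst_XY_const: "subst_XY (const_poly c) P Q = const_poly c"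
  by (simp add: subst_XY_def map_poly_pCons)

lemma scale_XY_conv_mult: "scale_XY c F = const_poly c * F"
  by (simp add: scale_XY_def)

lemma gl2_act_add: "gl2_act A (F + G) = gl2_act A F + gl2_act A G"
  by (simp add: gl2_act_def subst_XY_add)

lemma gl2_act_mult: "gl2_act A (F * G) = gl2_act A F * gl2_act A G"
  by (simp add: gl2_act_def subst_XY_mult)

lemma gl2_act_scale: "gl2_act A (scale_XY c F) = scale_XY c (gl2_act A F)"
  unfolding scale_XY_conv_mult gl2_act_mult by (simp add: gl2_act_def subst_XY_const)

lemma gl2_act_1: "gl2_act A 1 = 1"
  using subst_XY_const[of 1] by (simp add: gl2_act_def one_pCons)

lemma gl2_act_power: "gl2_act A (F ^ m) = gl2_act A F ^ m"
  by (induction m) (simp_all add: gl2_act_1 gl2_act_mult)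

definition linear_form :: "'k::field \<Rightarrow> 'k \<Rightarrow> 'k poly poly"
  where "linear_form a c = scale_XY a varX + scale_XY c varY"

lemma linear_form_eq: "linear_form a c = [:[:0, a:], [:c:]:]"
  by (simp add: linear_form_def scale_XY_def varX_def varY_def)

lemma varX_eq_linear_form: "varX = linear_form 1 0" and varY_eq_linear_form: "varY = linear_form 0 1"
  by (simp_all add: linear_form_eq varX_def varY_def one_pCons)

lemma gl2_act_linear_form:
  "gl2_act A (linear_form a c) =
    linear_form (a * A $ 1 $ 1 + c * A $ 1 $ 2) (a * A $ 2 $ 1 + c * A $ 2 $ 2)"
proof -
  have "gl2_act A (linear_form a c) = 
      scale_XY a (linear_form (A $ 1 $ 1) (A $ 2 $ 1)) + scale_XY c (linear_form (A $ 1 $ 2) (A $ 2 $ 2))"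
    unfolding linear_form_def[of a c] gl2_act_add gl2_act_scale
    by (simp add: gl2_act_def subst_XY_def varX_def varY_def map_poly_pCons linear_form_def pCons_one)
  thus ?thesis
    by (simp add: linear_form_eq scale_XY_def mult.commute)
qed

lemma homogeneous_mult:
  assumes "F \<in> homogeneous m" and "G \<in> homogeneous n"
  shows "F * G \<in> homogeneous (m + n)"
  unfolding homogeneous_def
proof safe
  fix i j assume "coeff (coeff (F * G) j) i \<noteq> 0"
  hence "(\<Sum>k\<le>j. \<Sum>l\<le>i. coeff (coeff F k) l * coeff (coeff G (j - k)) (i - l)) \<noteq> 0"
    by (simp add: coeff_mult coeff_sum)
  then obtain k l where "k \<le> j" "l \<le> i" "coeff (coeff F k) l * coeff (coeff G (j - k)) (i - l) \<noteq> 0"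
    by (metis (no_types, lifting) atMost_iff sum.neutral)
  moreover from this have "l + k = m" "(i - l) + (j - k) = n"
    using assms by (auto simp: homogeneous_def)
  ultimately show "i + j = m + n"
    by linarith
qed

lemma linear_form_power_homogeneous: "linear_form a c ^ m \<in> homogeneous m"
proof (induction m)
  case 0
  show ?case by (auto simp: homogeneous_def one_pCons coeff_pCons split: nat.splits)
next
  case (Suc m)
  have "linear_form a c \<in> homogeneous 1"
    by (auto simp: homogeneous_def linear_form_eq coeff_pCons split: nat.splits)
  from homogeneous_mult[OF this Suc] show ?case by simp
qed

lemma subspace_homogeneous: "poly_XY.subspace (homogeneous m :: 'k::field poly poly set)"
  unfolding poly_XY.subspace_def
proof (intro conjI ballI allI)
  show "0 \<in> homogeneous m"
    by (simp add: homogeneous_def)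
next
  fix F G :: "'k poly poly" assume "F \<in> homogeneous m" "G \<in> homogeneous m"
  thus "F + G \<in> homogeneous m"
    unfolding homogeneous_def by (auto, metis add_0)
next
  fix c :: 'k and F :: "'k poly poly" assume "F \<in> homogeneous m"
  thus "scale_XY c F \<in> homogeneous m"
    by (auto simp: homogeneous_def scale_XY_def)
qed

context prime_field
begin

lemma frobenius_add: "(F + G :: 'k poly poly) ^ p = F ^ p + G ^ p"
  by (rule freshmans_dream) (simp_all add: CHAR_k prime_p)

lemma linear_form_power_p: "linear_form (b::'k) d ^ p = scale_XY b (varX ^ p) + scale_XY d (varY ^ p)"
proof -
  have "const_poly (c::'k) ^ p = const_poly c" for c
    by (simp add: power_p poly_const_pow)
  thus ?thesis
    by (simp add: linear_form_def frobenius_add scale_XY_conv_mult power_mult_distrib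
        del: mult_pCons_left)
qed

text \<open>
  Dependent pairs of linear forms are admitted, which makes the span stable under every
  linear substitution at once.
\<close>

definition power_products :: "nat \<Rightarrow> 'k poly poly set"
  where "power_products s = {linear_form a c ^ s * linear_form b d ^ p |a b c d. True}"

lemma power_productsI: "linear_form a c ^ s * linear_form b d ^ p \<in> power_products s"
  by (auto simp: power_products_def)

lemma gl2_submodule_span_power_products:
  "gl2_submodule (s + p) (poly_XY.span (power_products s))"
  unfolding gl2_submodule_def
proof (intro conjI allI impI)
  show "poly_XY.span (power_products s) \<subseteq> homogeneous (s + p)"
    by (rule poly_XY.span_minimal)
       (auto simp: power_products_def subspace_homogeneous
             intro: homogeneous_mult linear_form_power_homogeneous)
  show "poly_XY.subspace (poly_XY.span (power_products s))"
    by (rule poly_XY.subspace_span)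
next
  fix A :: "'k ^ 2 ^ 2" and F assume "F \<in> poly_XY.span (power_products s)"
  thus "gl2_act A F \<in> poly_XY.span (power_products s)"
  proof (induction F rule: poly_XY.span_induct_alt)
    case base
    show ?case
      using gl2_act_scale[of A 0 0] by (simp add: poly_XY.span_zero)
  next
    case (step c F G)
    from step(1) obtain a b a' b' where "F = linear_form a b ^ s * linear_form a' b' ^ p"
      by (auto simp: power_products_def)
    hence "gl2_act A F \<in> power_products s"
      by (simp add: gl2_act_mult gl2_act_power gl2_act_linear_form power_productsI)
    thus ?case
      using step(2)
      by (auto simp: gl2_act_add gl2_act_scale intro: poly_XY.span_add poly_XY.span_scale poly_XY.span_base)
  qed
qed

text \<open>
  Products with independent \<open>L\<close> and \<open>M\<close> are the images of the generator under the group; the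
  remaining ones are reached by the additivity of \<open>p\<close>-th powers.
\<close>

lemma generated_submodule_eq_span:
  assumes "s > 0"
  shows "generated_submodule (s + p) (varX ^ s * varY ^ p) = poly_XY.span (power_products s)"
  unfolding generated_submodule_def
proof (rule hull_unique)
  show "{varX ^ s * varY ^ p} \<subseteq> poly_XY.span (power_products s)"
    using power_productsI[of 1 0 s 0 1]
    by (auto simp: varX_eq_linear_form varY_eq_linear_form intro: poly_XY.span_base)
  show "gl2_submodule (s + p) (poly_XY.span (power_products s))"
    by (rule gl2_submodule_span_power_products)
next
  fix W :: "'k poly poly set"
  assume W: "{varX ^ s * varY ^ p} \<subseteq> W" "gl2_submodule (s + p) W"
  have subspace: "poly_XY.subspace W"
    using W by (simp add: gl2_submodule_def)
  have independent: "linear_form a c ^ s * linear_form b d ^ p \<in> W" if "a * d \<noteq> b * c" for a b c d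
  proof -
    define A :: "'k ^ 2 ^ 2" where "A = (\<chi> i j. if i = 1 then if j = 1 then a else b else if j = 1 then c else d)"
    have A: "A $ 1 $ 1 = a" "A $ 1 $ 2 = b" "A $ 2 $ 1 = c" "A $ 2 $ 2 = d"
      by (simp_all add: A_def)
    have "invertible A"
      using that by (simp add: invertible_det_nz det_2 A)
    hence "gl2_act A (varX ^ s * varY ^ p) \<in> W"
      using W by (simp add: gl2_submodule_def)
    thus ?thesis
      by (simp add: gl2_act_mult gl2_act_power varX_eq_linear_form varY_eq_linear_form gl2_act_linear_form A)
  qed
  have "linear_form a c ^ s * linear_form b d ^ p \<in> W" for a b c d
  proof (cases "a * d = b * c")
    case dependent: True
    show ?thesis
    proof (cases "a = 0 \<and> c = 0")
      case True
      hence "linear_form a c = 0"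
        by (simp add: linear_form_eq)
      thus ?thesis
        using assms poly_XY.subspace_0[OF subspace] by (simp add: power_0_left)
    next
      case False
      then obtain b' d' where *: "a * d' \<noteq> b' * c"
        by (metis mult_zero_left mult_zero_right mult_1_left mult_1_right)
      \<comment> \<open>By additivity of the \<open>p\<close>-th power, \<open>M ^ p = (M + N) ^ p - N ^ p\<close> for any \<open>N\<close>
          independent of \<open>L\<close>; then \<open>M + N\<close> is independent of \<open>L\<close> as well.\<close>
      have "linear_form b d ^ p = linear_form (b + b') (d + d') ^ p - linear_form b' d' ^ p"
        by (simp add: linear_form_power_p poly_XY.scale_left_distrib)
      moreover have "a * (d + d') \<noteq> (b + b') * c"
        using * dependent by (simp add: algebra_simps)
      ultimately show ?thesis
        using independent[OF *] independent[of a "d + d'" "b + b'" c] poly_XY.subspace_diff[OF subspace]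
        by (simp add: right_diff_distrib)
    qed
  qed (rule independent)
  thus "poly_XY.span (power_products s) \<subseteq> W"
    by (intro poly_XY.span_minimal subspace) (auto simp: power_products_def)
qed

end

section \<open>Coefficient functions\<close>

text \<open>
  Forms of degree \<open>r\<close> are handled through their coefficients as functions of the exponent of \<open>Y\<close>.
\<close>

definition binary_form :: "nat \<Rightarrow> (nat \<Rightarrow> 'k::field) \<Rightarrow> 'k poly poly"
  where "binary_form r f = (\<Sum>j\<le>r. monom (monom (f j) (r - j)) j)"

lemma scale_monom_XY: "scale_XY c (varX ^ i * varY ^ j) = monom (monom c i) j"
proof -
  have "varX ^ i = [:monom (1::'a) i:]"
    by (simp add: varX_def poly_const_pow monom_altdef)
  moreover have "varY ^ j = monom (1::'a poly) j"
    by (simp add: varY_def monom_altdef)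
  ultimately show ?thesis
    by (simp add: scale_XY_def smult_monom)
qed

lemma binary_form_eq_monomials:
  "binary_form r f = (\<Sum>j\<le>r. scale_XY (f j) (varX ^ (r - j) * varY ^ j))"
  by (simp add: binary_form_def scale_monom_XY)

lemma coeff_binary_form: "j \<le> r \<Longrightarrow> coeff (coeff (binary_form r f) j) (r - j) = f j"
  by (simp add: binary_form_def coeff_sum if_distrib[of "\<lambda>x. coeff x _"] cong: if_cong)

lemma binary_form_cong: "(\<And>j. j \<le> r \<Longrightarrow> f j = g j) \<Longrightarrow> binary_form r f = binary_form r g"
  by (simp add: binary_form_def)

lemma binary_form_eq_0_iff: "binary_form r f = 0 \<longleftrightarrow> (\<forall>j\<le>r. f j = 0)"
  using coeff_binary_form[of _ r f] by (auto simp: binary_form_def) 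

lemma binary_form_add: "binary_form r (\<lambda>j. f j + g j) = binary_form r f + binary_form r g"
  by (simp add: binary_form_def add_monom sum.distrib flip: add_monom)

lemma binary_form_scale: "binary_form r (\<lambda>j. c * f j) = scale_XY c (binary_form r f)"
  by (simp add: binary_form_eq_monomials poly_XY.scale_sum_right)

lemma binary_form_sum: "binary_form r (\<lambda>j. \<Sum>i\<in>I. f i j) = (\<Sum>i\<in>I. binary_form r (f i))"
proof (induction I rule: infinite_finite_induct)
  case (insert i I)
  thus ?case by (simp add: binary_form_add)
qed (simp_all add: binary_form_eq_0_iff)

definition delta :: "nat \<Rightarrow> nat \<Rightarrow> 'k::field"
  where "delta e j = (if j = e then 1 else 0)"

lemma binary_form_delta: "e \<le> r \<Longrightarrow> binary_form r (delta e) = varX ^ (r - e) * varY ^ e"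
  by (simp add: binary_form_eq_monomials delta_def if_distrib[of "\<lambda>c. scale_XY c _"] cong: if_cong)

text \<open>
  Stated for an indexed family, so that the dimension is the number of indices; that distinct
  indices give distinct vectors is part of the independence.
\<close>

lemma dim_span_binary_forms:
  fixes u :: "'i \<Rightarrow> nat \<Rightarrow> 'k::field"
  assumes "finite I"
    and independent: "\<And>c i. (\<And>j. j \<le> r \<Longrightarrow> (\<Sum>i\<in>I. c i * u i j) = 0) \<Longrightarrow> i \<in> I \<Longrightarrow> c i = 0"
  shows "poly_XY.dim (poly_XY.span ((\<lambda>i. binary_form r (u i)) ` I)) = card I"
proof -
  let ?v = "\<lambda>i. binary_form r (u i)"
  have zero: "c i = 0" if "(\<Sum>i\<in>I. scale_XY (c i) (?v i)) = 0" "i \<in> I" for c i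
  proof (rule independent)
    fix j assume "j \<le> r"
    have "binary_form r (\<lambda>j. \<Sum>i\<in>I. c i * u i j) = 0"
      using that by (simp add: binary_form_sum binary_form_scale)
    thus "(\<Sum>i\<in>I. c i * u i j) = 0"
      using \<open>j \<le> r\<close> by (simp add: binary_form_eq_0_iff)
  qed fact
  have inj: "inj_on ?v I"
  proof (rule inj_onI, rule ccontr)
    fix i i' assume i: "i \<in> I" "i' \<in> I" "?v i = ?v i'" "i \<noteq> i'"
    define c where "c = (\<lambda>l. if l = i then 1 else if l = i' then -1 else (0::'k))"
    have "(\<Sum>l\<in>I. scale_XY (c l) (?v l)) = (\<Sum>l\<in>{i, i'}. scale_XY (c l) (?v l))"
      by (rule sum.mono_neutral_right) (use i assms in \<open>auto simp: c_def\<close>)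
    also have "\<dots> = 0"
      using i by (simp add: c_def)
    finally have "c i = 0"
      using zero i by blast
    thus False
      by (simp add: c_def)
  qed
  have "poly_XY.independent (?v ` I)"
  proof (rule poly_XY.independent_if_scalars_zero)
    fix g x assume *: "(\<Sum>x\<in>?v ` I. scale_XY (g x) x) = 0" "x \<in> ?v ` I"
    hence "(\<Sum>i\<in>I. scale_XY (g (?v i)) (?v i)) = 0"
      by (simp add: sum.reindex[OF inj])
    thus "g x = 0"
      using zero[of "\<lambda>i. g (?v i)"] * by auto
  qed (use assms in simp)
  thus ?thesis
    by (simp add: poly_XY.dim_eq_card_independent card_image[OF inj])
qed

section \<open>Splitting the module by exponents modulo p - 1\<close>

locale monomial_module = prime_field p ty for p and ty :: "'k::field itself" +
  fixes s :: nat
  assumes s_ge: "s \<ge> 2 * p\<^sup>2"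
begin

abbreviation form :: "(nat \<Rightarrow> 'k) \<Rightarrow> 'k poly poly"
  where "form \<equiv> binary_form (s + p)"

text \<open>
  The exponents of \<open>X^r\<close>, \<open>X^s Y^p\<close>, \<open>X^p Y^s\<close> and \<open>Y^r\<close>. These monomials lie in the module
  individually, so the rest of the module only matters modulo their span.
\<close>

definition corners :: "nat set"
  where "corners = {0, p, s, s + p}"

definition exponents :: "nat \<Rightarrow> nat set"
  where "exponents b = {j. j \<le> s + p \<and> j \<notin> corners \<and> [j = b] (mod (p - 1))}"

definition class_part :: "nat \<Rightarrow> (nat \<Rightarrow> 'k) \<Rightarrow> nat \<Rightarrow> 'k"
  where "class_part b f j = (if j \<in> exponents b then f j else 0)"

text \<open>
  The coefficients of \<open>(X + Y)^s Y^p\<close>, just as those of \<open>(X + Y)^s X^p\<close> are \<open>bin s\<close>.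
\<close>

definition shifted_bin :: "nat \<Rightarrow> 'k"
  where "shifted_bin j = (if p \<le> j then bin s (j - p) else 0)"

abbreviation generators :: "(nat \<Rightarrow> 'k) set"
  where "generators \<equiv> delta ` corners \<union> (\<lambda>b. class_part b (bin s)) ` {1..p-1} \<union>
    (\<lambda>b. class_part b shifted_bin) ` {1..p-1}"

lemma s_gt: "s > p * (p - 1) + p" "s > p" "s > 0"
proof -
  have "p * (p - 1) + p = p * p"
    using p_gt_1 by (simp add: algebra_simps)
  moreover have "0 < p * p"
    using p_gt_1 by simp
  moreover have "2 * (p * p) \<le> s"
    using s_ge by (simp only: power2_eq_square)
  ultimately show "s > p * (p - 1) + p"
    by linarith
  thus "s > p" "s > 0" by simp_all
qed

lemma finite_corners [simp]: "finite corners"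
  by (simp add: corners_def)

lemma card_corners: "card corners = 4"
  using s_gt p_gt_1 by (simp add: corners_def)

lemma corners_le: "e \<in> corners \<Longrightarrow> e \<le> s + p"
  by (auto simp: corners_def)

lemma exponents_unique:
  assumes "j \<in> exponents b" "j \<in> exponents b'" "b \<in> {1..p-1}" "b' \<in> {1..p-1}"
  shows "b = b'"
proof -
  have *: "[b = b'] (mod (p - 1))"
    using assms(1,2) unfolding exponents_def cong_def by simp
  have "b' \<le> b"
    by (rule cong_imp_eq_or_larger[OF *]) (use assms(3,4) in auto)
  moreover have "b \<le> b'"
    by (rule cong_imp_eq_or_larger[OF cong_sym[OF *]]) (use assms(3,4) in auto)
  ultimately show ?thesis
    by (simp add: le_antisym)
qed

lemma ex_exponents:
  assumes "j \<le> s + p" "j \<notin> corners"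
  shows "\<exists>b\<in>{1..p-1}. j \<in> exponents b"
  using ex_positive_residue[of j] assms by (auto simp: exponents_def)

lemma exponents_pos: "j \<in> exponents b \<Longrightarrow> j > 0"
  by (cases "j = 0") (simp_all add: exponents_def corners_def)

lemma sum_delta_corners:
  "(\<Sum>e\<in>corners. f e * delta e j) = (if j \<in> corners then f j else (0::'k))"
proof -
  have "(\<Sum>e\<in>corners. f e * delta e j) = (\<Sum>e\<in>corners. if j = e then f e else 0)"
    by (rule sum.cong) (simp_all add: delta_def)
  also have "\<dots> = (if j \<in> corners then f j else 0)"
    by (rule sum.delta'[OF finite_corners])
  finally show ?thesis .
qed

lemma form_decompose:
  "form f = (\<Sum>e\<in>corners. scale_XY (f e) (form (delta e))) + (\<Sum>b\<in>{1..p-1}. form (class_part b f))"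
proof -
  have "form f = form (\<lambda>j. (\<Sum>e\<in>corners. f e * delta e j) + (\<Sum>b\<in>{1..p-1}. class_part b f j))"
  proof (rule binary_form_cong)
    fix j assume j: "j \<le> s + p"
    show "f j = (\<Sum>e\<in>corners. f e * delta e j) + (\<Sum>b\<in>{1..p-1}. class_part b f j)"
    proof (cases "j \<in> corners")
      case True
      hence "class_part b f j = 0" for b
        by (simp add: class_part_def exponents_def)
      thus ?thesis
        using True by (simp add: sum_delta_corners)
    next
      case False
      then obtain b where b: "b \<in> {1..p-1}" "j \<in> exponents b"
        using ex_exponents j by blast
      have "(\<Sum>b\<in>{1..p-1}. class_part b f j) = (\<Sum>b'\<in>{b}. class_part b' f j)"
      proof (rule sum.mono_neutral_right)
        have "j \<notin> exponents b'" if "b' \<in> {1..p-1} - {b}" for b'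
          using exponents_unique b that by blast
        thus "\<forall>b'\<in>{1..p-1} - {b}. class_part b' f j = 0"
          by (simp add: class_part_def)
      qed (use b in auto)
      thus ?thesis
        using b False by (simp add: sum_delta_corners class_part_def)
    qed
  qed
  thus ?thesis
    by (simp add: binary_form_add binary_form_sum binary_form_scale)
qed

lemma linear_form_power_expansion: 
  "linear_form 1 t ^ s = (\<Sum>j\<le>s. scale_XY (bin s j * t ^ j) (varX ^ (s - j) * varY ^ j))"
proof -
  have const: "const_poly c ^ j = const_poly (c ^ j)" for c :: 'k and j
    by (simp add: poly_const_pow)
  have "linear_form 1 t ^ s = (scale_XY t varY + varX) ^ s"
    by (simp add: linear_form_def add.commute)
  also have "\<dots> = (\<Sum>j\<le>s. of_nat (s choose j) * scale_XY t varY ^ j * varX ^ (s - j))"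
    by (rule binomial_ring)
  also have "\<dots> = (\<Sum>j\<le>s. scale_XY (bin s j * t ^ j) (varX ^ (s - j) * varY ^ j))"
  proof (rule sum.cong)
    fix j
    have "scale_XY (bin s j * t ^ j) F = of_nat (s choose j) * (const_poly t ^ j * F)" for F
      by (simp add: scale_XY_def const bin_def of_nat_poly)
    thus "of_nat (s choose j) * scale_XY t varY ^ j * varX ^ (s - j) =
        scale_XY (bin s j * t ^ j) (varX ^ (s - j) * varY ^ j)"
      by (simp only: scale_XY_conv_mult power_mult_distrib mult_ac)
  qed simp
  finally show ?thesis .
qed

lemma form_power_X: "linear_form 1 t ^ s * varX ^ p = form (\<lambda>j. bin s j * t ^ j)"
proof -
  have "form (\<lambda>j. bin s j * t ^ j) = 
      (\<Sum>j\<le>s. scale_XY (bin s j * t ^ j) (varX ^ (s + p - j) * varY ^ j))"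
    unfolding binary_form_eq_monomials by (rule sum.mono_neutral_right) (auto simp: bin_eq_0)
  also have "\<dots> = linear_form 1 t ^ s * varX ^ p"
    unfolding linear_form_power_expansion sum_distrib_right
  proof (rule sum.cong)
    fix j assume "j \<in> {..s}"
    hence "s + p - j = s - j + p"
      by simp
    thus "scale_XY (bin s j * t ^ j) (varX ^ (s + p - j) * varY ^ j) =
        scale_XY (bin s j * t ^ j) (varX ^ (s - j) * varY ^ j) * varX ^ p"
      by (simp only: scale_XY_conv_mult mult_ac power_add)
  qed simp
  finally show ?thesis ..
qed

lemma form_power_Y: "linear_form 1 t ^ s * varY ^ p = form (\<lambda>j. shifted_bin j * t ^ (j - p))"
proof -
  have "form (\<lambda>j. shifted_bin j * t ^ (j - p)) = 
      (\<Sum>j\<in>{p..s+p}. scale_XY (bin s (j - p) * t ^ (j - p)) (varX ^ (s + p - j) * varY ^ j))"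
    unfolding binary_form_eq_monomials
    by (rule sum.mono_neutral_cong_right) (auto simp: shifted_bin_def)
  also have "\<dots> = (\<Sum>j\<in>{0..s}. scale_XY (bin s j * t ^ j) (varX ^ (s - j) * varY ^ (j + p)))"
    using sum.shift_bounds_cl_nat_ivl[of "\<lambda>j. scale_XY (bin s (j - p) * t ^ (j - p)) (varX ^ (s + p - j) * varY ^ j)" 0 p s] by simp
  also have "\<dots> = linear_form 1 t ^ s * varY ^ p"
    unfolding linear_form_power_expansion sum_distrib_right atLeast0AtMost
    by (rule sum.cong) (simp_all only: scale_XY_conv_mult mult_ac power_add)
  finally show ?thesis ..
qed

lemma power_times_varX_varY_in_span:
  defines "W \<equiv> poly_XY.span (power_products s)"
  shows "linear_form a c ^ s * varX ^ p \<in> W" and "linear_form a c ^ s * varY ^ p \<in> W"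
  using power_productsI[of a c s 1 0] power_productsI[of a c s 0 1]
  by (auto simp: W_def varX_eq_linear_form varY_eq_linear_form intro: poly_XY.span_base)

lemma form_delta_in_span:
  assumes "e \<in> corners"
  shows "form (delta e) \<in> poly_XY.span (power_products s)"
proof -
  have "e = 0 \<or> e = p \<or> e = s \<or> e = s + p"
    using assms by (simp add: corners_def)
  hence "form (delta e) \<in> {varX ^ s * varX ^ p, varX ^ s * varY ^ p, varY ^ s * varX ^ p, varY ^ s * varY ^ p}"
    by (elim disjE) (simp_all add: binary_form_delta power_add mult.commute[of "varX ^ p"])
  thus ?thesis
    using power_times_varX_varY_in_span[of 1 0] power_times_varX_varY_in_span[of 0 1]
    unfolding varX_eq_linear_form[symmetric] varY_eq_linear_form[symmetric] by auto
qed

text \<open>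
  Membership in the module is insensitive to the coefficients at the corners.
\<close>

lemma form_off_corners_in_span:
  assumes "form f \<in> poly_XY.span (power_products s)"
  shows "form (\<lambda>j. if j \<in> corners then 0 else f j) \<in> poly_XY.span (power_products s)"
proof -
  have "form f = form (\<lambda>j. (if j \<in> corners then 0 else f j) + (\<Sum>e\<in>corners. f e * delta e j))"
    by (rule binary_form_cong) (simp add: sum_delta_corners)
  hence "form (\<lambda>j. if j \<in> corners then 0 else f j) =
      form f - (\<Sum>e\<in>corners. scale_XY (f e) (form (delta e)))"
    by (simp add: binary_form_add binary_form_sum binary_form_scale)
  also have "\<dots> \<in> poly_XY.span (power_products s)"
    by (intro poly_XY.span_diff poly_XY.span_sum poly_XY.span_scale assms form_delta_in_span)
  finally show ?thesis .
qed

lemma sum_powers_detects_residue: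
  assumes "i > 0" "[i + b = j] (mod (p - 1))"
  shows "(\<Sum>t\<in>UNIV. (t::'k) ^ i) = (if [j = b] (mod (p - 1)) then -1 else 0)"
proof -
  have "(p - 1) dvd i \<longleftrightarrow> [i + b = 0 + b] (mod (p - 1))"
    by (simp only: cong_add_rcancel_nat cong_0_iff)
  also have "\<dots> \<longleftrightarrow> [j = b] (mod (p - 1))"
    using assms(2) by (simp add: cong_def)
  finally show ?thesis
    using sum_powers[OF assms(1)] by simp
qed

text \<open>
  The sum over \<open>t\<close> of \<open>t ^ m\<close> times the given vectors has \<open>f j\<close> multiplied by a power sum
  with exponent \<open>m + h j\<close>, which is \<open>-1\<close> in the class of \<open>b\<close> and \<open>0\<close> outside it.
  The offset \<open>m\<close> is to be chosen for that; where \<open>f\<close> does not vanish, the exponent \<open>0\<close>, for which the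
  filter fails, may occur at corners only.
\<close>

lemma form_class_part_in_span:
  assumes in_span: "\<And>t. form (\<lambda>j. f j * t ^ h j) \<in> poly_XY.span (power_products s)"
    and exponent: "\<And>j. j \<notin> corners \<Longrightarrow> f j \<noteq> 0 \<Longrightarrow> m + h j > 0 \<and> [m + h j + b = j] (mod (p - 1))"
  shows "form (class_part b f) \<in> poly_XY.span (power_products s)"
proof -
  define g where "g j = (\<Sum>t\<in>UNIV. t ^ m * (f j * t ^ h j))" for j
  have "form g = (\<Sum>t\<in>UNIV. scale_XY (t ^ m) (form (\<lambda>j. f j * t ^ h j)))"
    unfolding g_def by (simp add: binary_form_sum binary_form_scale)
  hence "form g \<in> poly_XY.span (power_products s)"
    by (auto intro!: poly_XY.span_sum poly_XY.span_scale in_span)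
  hence "scale_XY (-1) (form (\<lambda>j. if j \<in> corners then 0 else g j)) \<in> poly_XY.span (power_products s)"
    by (intro poly_XY.span_scale form_off_corners_in_span)
  also have "scale_XY (-1) (form (\<lambda>j. if j \<in> corners then 0 else g j)) = form (class_part b f)"
    unfolding binary_form_scale[symmetric]
  proof (rule binary_form_cong)
    fix j assume j: "j \<le> s + p"
    have "g j = f j * (\<Sum>t\<in>UNIV. t ^ (m + h j))"
      by (simp add: g_def sum_distrib_left power_add mult_ac)
    moreover have "(\<Sum>t\<in>UNIV. (t::'k) ^ (m + h j)) = (if [j = b] (mod (p - 1)) then -1 else 0)"
      if "j \<notin> corners" "f j \<noteq> 0"
      using exponent[OF that] by (intro sum_powers_detects_residue) auto
    ultimately show "-1 * (if j \<in> corners then 0 else g j) = class_part b f j"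
      using j by (cases "f j = 0") (auto simp: class_part_def exponents_def)
  qed
  finally show ?thesis .
qed

lemma form_generators_in_span:
  assumes "f \<in> generators"
  shows "form f \<in> poly_XY.span (power_products s)"
proof -
  have "form (class_part b (bin s)) \<in> poly_XY.span (power_products s)" if "b \<in> {1..p-1}" for b
  proof (rule form_class_part_in_span[where h = "\<lambda>j. j" and m = "p - 1 - b"])
    show "form (\<lambda>j. bin s j * t ^ j) \<in> poly_XY.span (power_products s)" for t
      using power_times_varX_varY_in_span(1)[of 1 t] by (simp add: form_power_X)
    fix j assume "j \<notin> corners"
    hence "j > 0"
      by (cases "j = 0") (simp_all add: corners_def)
    moreover have "p - 1 - b + j + b = j + (p - 1)"
      using that by auto
    ultimately show "p - 1 - b + j > 0 \<and> [p - 1 - b + j + b = j] (mod (p - 1))"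
      by (simp only: cong_def mod_add_self2) simp
  qed
  moreover have "form (class_part b shifted_bin) \<in> poly_XY.span (power_products s)" if "b \<in> {1..p-1}" for b
  proof (rule form_class_part_in_span[where h = "\<lambda>j. j - p" and m = "p - b"])
    show "form (\<lambda>j. shifted_bin j * t ^ (j - p)) \<in> poly_XY.span (power_products s)" for t
      using power_times_varX_varY_in_span(2)[of 1 t] by (simp add: form_power_Y)
    fix j assume "shifted_bin j \<noteq> 0"
    hence "p \<le> j"
      by (auto simp: shifted_bin_def split: if_splits)
    moreover have "p - b > 0"
      using that p_gt_1 by auto
    moreover from this have "p - b + (j - p) + b = j"
      using \<open>p \<le> j\<close> by simp
    ultimately show "p - b + (j - p) > 0 \<and> [p - b + (j - p) + b = j] (mod (p - 1))"
      by simp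
  qed
  ultimately show ?thesis
    using assms form_delta_in_span by auto
qed

text \<open>
  For the vectors obtained from \<open>(X + tY)^s\<close>, the factor \<open>c\<close> is the common value of a power of
  \<open>t\<close> on the class.
\<close>

lemma form_in_span_generators:
  assumes "\<And>b. b \<in> {1..p-1} \<Longrightarrow> \<exists>c. \<forall>j\<in>exponents b. f j = c * g j"
    and "\<And>b. b \<in> {1..p-1} \<Longrightarrow> class_part b g \<in> generators"
  shows "form f \<in> poly_XY.span (form ` generators)"
proof -
  have "form (class_part b f) \<in> poly_XY.span (form ` generators)" if b: "b \<in> {1..p-1}" for b
  proof -
    obtain c where "\<forall>j\<in>exponents b. f j = c * g j"
      using assms(1)[OF b] by blast
    hence "form (class_part b f) = form (\<lambda>j. c * class_part b g j)"
      by (intro binary_form_cong) (simp add: class_part_def)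
    also have "\<dots> \<in> poly_XY.span (form ` generators)"
      unfolding binary_form_scale using assms(2)[OF b]
      by (intro poly_XY.span_scale poly_XY.span_base imageI)
    finally show ?thesis .
  qed
  moreover have "form (delta e) \<in> poly_XY.span (form ` generators)" if "e \<in> corners" for e
    using that by (intro poly_XY.span_base) auto
  ultimately show ?thesis
    unfolding form_decompose[of f]
    by (intro poly_XY.span_add poly_XY.span_sum poly_XY.span_scale)
qed

lemma power_products_in_span_generators:
  "power_products s \<subseteq> poly_XY.span (form ` generators)"
proof -
  let ?W = "poly_XY.span (form ` generators)"
  have delta: "form (delta e) \<in> ?W" if "e \<in> corners" for e
    using that by (intro poly_XY.span_base) auto
  have X: "linear_form 1 t ^ s * varX ^ p \<in> ?W" for t
    unfolding form_power_X
  proof (rule form_in_span_generators)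
    fix b assume b: "b \<in> {1..p-1}"
    have "bin s j * t ^ j = t ^ b * bin s j" if "j \<in> exponents b" for j
      using power_cong[of j b t] exponents_pos[OF that] that b by (simp add: exponents_def)
    thus "\<exists>c. \<forall>j\<in>exponents b. bin s j * t ^ j = c * bin s j"
      by blast
    show "class_part b (bin s) \<in> generators"
      using b by blast
  qed
  have Y: "linear_form 1 t ^ s * varY ^ p \<in> ?W" for t
    unfolding form_power_Y
  proof (rule form_in_span_generators)
    fix b assume b: "b \<in> {1..p-1}"
    \<comment> \<open>The exponent \<open>b + (p - 2)\<close> represents the class of \<open>b - 1\<close> and is positive even for \<open>b = 1\<close>.\<close>
    have "shifted_bin j * t ^ (j - p) = t ^ (b + (p - 2)) * shifted_bin j" if "j \<in> exponents b" for j
    proof (cases "p < j")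
      case True
      have "b + (p - 2) + p = b + (p - 1) + (p - 1)"
        using p_gt_1 by simp
      hence "[b + (p - 2) + p = b] (mod (p - 1))"
        by (simp only: cong_def mod_add_self2)
      moreover have "[j - p + p = b] (mod (p - 1))"
        using True that by (simp add: exponents_def)
      ultimately have "[j - p + p = b + (p - 2) + p] (mod (p - 1))"
        by (metis cong_sym cong_trans)
      hence "[j - p = b + (p - 2)] (mod (p - 1))"
        by (simp only: cong_add_rcancel_nat)
      thus ?thesis
        using power_cong[of "j - p" "b + (p - 2)" t] True b by simp
    next
      case False
      hence "shifted_bin j = 0"
        using that by (auto simp: shifted_bin_def exponents_def corners_def)
      thus ?thesis by simp
    qed
    thus "\<exists>c. \<forall>j\<in>exponents b. shifted_bin j * t ^ (j - p) = c * shifted_bin j"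
      by blast
    show "class_part b shifted_bin \<in> generators"
      using b by blast
  qed
  have XY: "linear_form a c ^ s * varX ^ p \<in> ?W \<and> linear_form a c ^ s * varY ^ p \<in> ?W" for a c
  proof (cases "a = 0")
    case True
    hence "linear_form a c = scale_XY c varY"
      by (simp add: linear_form_def)
    hence "linear_form a c ^ s * F = scale_XY (c ^ s) (varY ^ s * F)" for F
      by (simp add: scale_XY_conv_mult power_mult_distrib poly_const_pow mult.assoc del: mult_pCons_left)
    moreover have "varY ^ s * varX ^ p = form (delta s)" "varY ^ s * varY ^ p = form (delta (s + p))"
      by (simp_all add: binary_form_delta power_add mult.commute)
    ultimately show ?thesis
      using delta[of s] delta[of "s + p"] by (auto simp: corners_def intro: poly_XY.span_scale)
  next
    case False
    hence "linear_form a c = scale_XY a (linear_form 1 (c / a))"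
      by (simp add: linear_form_eq scale_XY_def)
    hence "linear_form a c ^ s * F = scale_XY (a ^ s) (linear_form 1 (c / a) ^ s * F)" for F
      by (simp add: scale_XY_conv_mult power_mult_distrib poly_const_pow mult.assoc del: mult_pCons_left)
    thus ?thesis
      using X Y by (auto intro: poly_XY.span_scale)
  qed
  show ?thesis
  proof
    fix F assume "F \<in> power_products s"
    then obtain a c b d where "F = linear_form a c ^ s * linear_form b d ^ p"
      by (auto simp: power_products_def)
    hence "F = scale_XY b (linear_form a c ^ s * varX ^ p) + scale_XY d (linear_form a c ^ s * varY ^ p)"
      by (simp only: linear_form_power_p scale_XY_conv_mult distrib_left mult_ac)
    thus "F \<in> ?W"
      using XY by (auto intro: poly_XY.span_add poly_XY.span_scale)
  qed
qed

lemma span_power_products_eq: "poly_XY.span (power_products s) = poly_XY.span (form ` generators)"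
  unfolding poly_XY.span_eq using power_products_in_span_generators form_generators_in_span by blast

section \<open>The dimension as a count of residue classes\<close>

lemma sum_class_part:
  assumes "j \<in> exponents b" "b \<in> {1..p-1}" "S \<subseteq> {1..p-1}"
  shows "(\<Sum>b'\<in>S. c b' * class_part b' f j) = (if b \<in> S then c b else 0) * f j"
proof -
  have "c b' * class_part b' f j = (if b' = b then c b * f j else 0)" if "b' \<in> S" for b'
  proof (cases "b' = b")
    case False
    hence "j \<notin> exponents b'"
      using exponents_unique assms that by blast
    thus ?thesis
      using False by (simp add: class_part_def)
  qed (use assms in \<open>simp add: class_part_def\<close>)
  hence "(\<Sum>b'\<in>S. c b' * class_part b' f j) = (\<Sum>b'\<in>S. if b' = b then c b * f j else 0)"
    by (rule sum.cong[OF refl])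
  also have "\<dots> = (if b \<in> S then c b else 0) * f j"
    using finite_subset[OF assms(3)] by (simp add: sum.delta)
  finally show ?thesis .
qed

lemma class_part_corner: "e \<in> corners \<Longrightarrow> class_part b f e = 0"
  by (simp add: class_part_def exponents_def)

abbreviation adapted :: "(nat \<Rightarrow> 'k) \<Rightarrow> nat set \<Rightarrow> nat set \<Rightarrow> (nat \<Rightarrow> 'k) set"
  where "adapted g S T \<equiv> delta ` corners \<union> (\<lambda>b. class_part b (bin s)) ` S \<union> (\<lambda>b. class_part b g) ` T"

text \<open>
  The supports of different classes are disjoint, so independence may be tested class by class.
\<close>

lemma dim_span_adapted:
  assumes S: "S \<subseteq> {1..p-1}" and T: "T \<subseteq> {1..p-1}"
    and indep: "\<And>b x y. b \<in> {1..p-1} \<Longrightarrow> (\<And>j. j \<in> exponents b \<Longrightarrow> x * bin s j + y * g j = 0)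
      \<Longrightarrow> (b \<in> S \<longrightarrow> x = 0) \<and> (b \<in> T \<longrightarrow> y = 0)"
  shows "poly_XY.dim (poly_XY.span (form ` adapted g S T)) = 4 + card S + card T"
proof -
  define u :: "nat + nat + nat \<Rightarrow> nat \<Rightarrow> 'k"
    where "u = case_sum delta (case_sum (\<lambda>b. class_part b (bin s)) (\<lambda>b. class_part b g))"
  let ?I = "corners <+> (S <+> T)"
  have fin: "finite S" "finite T"
    using S T by (auto intro: finite_subset)
  have image: "(\<lambda>i. form (u i)) ` ?I = form ` adapted g S T"
    by (simp add: Plus_def image_Un image_image u_def Un_assoc)
  have "poly_XY.dim (poly_XY.span ((\<lambda>i. form (u i)) ` ?I)) = card ?I"
  proof (rule dim_span_binary_forms)
    fix c i assume zero: "\<And>j. j \<le> s + p \<Longrightarrow> (\<Sum>i\<in>?I. c i * u i j) = 0" and i: "i \<in> ?I"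
    have split: "(\<Sum>e\<in>corners. c (Inl e) * delta e j) +
        ((\<Sum>b\<in>S. c (Inr (Inl b)) * class_part b (bin s) j) + (\<Sum>b\<in>T. c (Inr (Inr b)) * class_part b g j)) = 0"
      if "j \<le> s + p" for j
      using zero[OF that] fin by (simp add: sum.Plus u_def)
    have corner: "c (Inl e) = 0" if "e \<in> corners" for e
      using split[of e] that corners_le[OF that] by (simp add: sum_delta_corners class_part_corner)
    have block: "(b \<in> S \<longrightarrow> c (Inr (Inl b)) = 0) \<and> (b \<in> T \<longrightarrow> c (Inr (Inr b)) = 0)"
      if b: "b \<in> {1..p-1}" for b
    proof -
      let ?x = "if b \<in> S then c (Inr (Inl b)) else 0" and ?y = "if b \<in> T then c (Inr (Inr b)) else 0"
      have "?x * bin s j + ?y * g j = 0" if j: "j \<in> exponents b" for j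
      proof -
        have "j \<le> s + p" "j \<notin> corners"
          using j by (auto simp: exponents_def)
        thus ?thesis
          using split[of j] unfolding sum_class_part[OF j b S] sum_class_part[OF j b T] sum_delta_corners
          by simp
      qed
      from indep[OF b this] show ?thesis by auto
    qed
    show "c i = 0"
      using i corner block S T by (auto simp: Plus_def)
  qed (use fin in simp)
  also have "card ?I = 4 + card S + card T"
    using fin by (simp add: card_Plus card_corners)
  finally show ?thesis
    by (simp only: image)
qed

text \<open>
  The parameter \<open>\<epsilon>\<close> allows the second vector of each class to be modified by a multiple of the
  first: it is \<open>0\<close> when \<open>p\<close> is added to \<open>s\<close> without a carry and \<open>1\<close> when a carry occurs. The sets \<open>S\<close>
  and \<open>T\<close> consist of the classes in which the first, respectively second, vector belongs to the basis.
\<close>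

lemma dim_module_eq:
  assumes g: "\<And>j. g j = shifted_bin j + \<epsilon> * bin s j"
    and S: "S \<subseteq> {1..p-1}" and T: "T \<subseteq> {1..p-1}"
    and outside_S: "\<And>b j. b \<in> {1..p-1} - S \<Longrightarrow> j \<in> exponents b \<Longrightarrow> bin s j = 0"
    and outside_T: "\<And>b j. b \<in> {1..p-1} - T \<Longrightarrow> j \<in> exponents b \<Longrightarrow> g j = 0"
    and indep: "\<And>b x y. b \<in> {1..p-1} \<Longrightarrow> (\<And>j. j \<in> exponents b \<Longrightarrow> x * bin s j + y * g j = 0)
      \<Longrightarrow> (b \<in> S \<longrightarrow> x = 0) \<and> (b \<in> T \<longrightarrow> y = 0)"
  shows "poly_XY.dim (poly_XY.span (power_products s)) = 4 + card S + card T"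
proof -
  let ?A = "poly_XY.span (form ` adapted g S T)" and ?G = "poly_XY.span (form ` generators)"
  have A_bin: "form (class_part b (bin s)) \<in> ?A" if "b \<in> {1..p-1}" for b
  proof (cases "b \<in> S")
    case False
    hence "form (class_part b (bin s)) = 0"
      using that outside_S by (auto simp: binary_form_eq_0_iff class_part_def)
    thus ?thesis by (simp add: poly_XY.span_zero)
  qed (auto intro: poly_XY.span_base)
  have A_g: "form (class_part b g) \<in> ?A" if "b \<in> {1..p-1}" for b
  proof (cases "b \<in> T")
    case False
    hence "form (class_part b g) = 0"
      using that outside_T by (auto simp: binary_form_eq_0_iff class_part_def)
    thus ?thesis by (simp add: poly_XY.span_zero)
  qed (auto intro: poly_XY.span_base)
  have form_g: "form (class_part b g) = form (class_part b shifted_bin) + scale_XY \<epsilon> (form (class_part b (bin s)))" for b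
    unfolding binary_form_scale[symmetric] binary_form_add[symmetric]
    by (rule binary_form_cong) (simp add: class_part_def g)
  have "form (class_part b shifted_bin) \<in> ?A" if "b \<in> {1..p-1}" for b
  proof -
    have "form (class_part b shifted_bin) = form (class_part b g) - scale_XY \<epsilon> (form (class_part b (bin s)))"
      by (simp add: form_g)
    also have "\<dots> \<in> ?A"
      by (intro poly_XY.span_diff poly_XY.span_scale A_bin A_g that)
    finally show ?thesis .
  qed
  hence "form ` generators \<subseteq> ?A"
    using A_bin by (auto intro: poly_XY.span_base)
  moreover have "form ` adapted g S T \<subseteq> ?G"
  proof -
    have "form (class_part b g) \<in> ?G" if "b \<in> T" for b
      unfolding form_g using that T
      by (intro poly_XY.span_add poly_XY.span_scale poly_XY.span_base imageI) auto
    moreover have "form (class_part b (bin s)) \<in> ?G" if "b \<in> S" for b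
      using that S by (intro poly_XY.span_base imageI) auto
    ultimately show ?thesis
      by (auto intro: poly_XY.span_base)
  qed
  ultimately have "?G = ?A"
    unfolding poly_XY.span_eq by blast
  thus ?thesis
    unfolding span_power_products_eq using dim_span_adapted[OF S T indep] by simp
qed

section \<open>Digits of s\<close>

definition s0 :: nat where "s0 = s mod p"
definition s1 :: nat where "s1 = s div p mod p"
definition q :: nat where "q = s div p div p"

lemma s_digits: "s = s0 + p * (s1 + p * q)"
  by (simp add: s0_def s1_def q_def)

lemma s0_less [simp]: "s0 < p" and s1_less [simp]: "s1 < p"
  using p_gt_1 by (simp_all add: s0_def s1_def)

lemma q_ge: "q \<ge> 2"
proof -
  have "2 * (p * p) \<le> s"
    using s_ge by (simp only: power2_eq_square)
  hence "2 \<le> s div (p * p)"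
    using p_gt_1 by (simp add: less_eq_div_iff_mult_less_eq)
  thus ?thesis
    by (simp add: q_def div_mult2_eq)
qed

lemma bin_s:
  "j0 < p \<Longrightarrow> j1 < p \<Longrightarrow> bin s (j0 + p * (j1 + p * j2)) = bin s0 j0 * (bin s1 j1 * bin q j2)"
  by (subst s_digits) (simp add: lucas_step)

lemma digit_sum_3:
  "j0 < p \<Longrightarrow> j1 < p \<Longrightarrow> digit_sum p (j0 + p * (j1 + p * j2)) = j0 + (j1 + digit_sum p j2)"
  by (simp add: digit_sum_step)

lemma second_digit: "j0 < p \<Longrightarrow> j1 < p \<Longrightarrow> (j0 + p * (j1 + p * j2)) div p mod p = j1"
  by simp

lemma digit_sum_s: "digit_sum p s = s0 + (s1 + digit_sum p q)"
  by (subst s_digits) (simp add: digit_sum_3)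

lemma shifted_bin_add: "shifted_bin (j + p) = bin s j"
  by (simp add: shifted_bin_def)

lemma bin_s_add_p: "bin (s + p) j = shifted_bin j + 1 * bin s j"
  by (simp add: bin_add_p shifted_bin_def)

lemma bin_neq_0_imp_le: "bin n j \<noteq> 0 \<Longrightarrow> j \<le> n"
  by (rule ccontr) (simp add: bin_eq_0)

text \<open>
  A strict inequality between digit sums keeps \<open>j\<close> away from \<open>0\<close> and \<open>s\<close>, and a nonzero binomial
  coefficient makes it at most \<open>s\<close>; among the corners this leaves only \<open>p\<close>.
\<close>

lemma in_exponentsI:
  assumes "bin s j \<noteq> 0" "0 < digit_sum p j" "digit_sum p j < digit_sum p s" "j \<noteq> p"
    and "[digit_sum p j = b] (mod (p - 1))"
  shows "j \<in> exponents b"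
proof -
  have "j \<noteq> 0"
    using assms(2) by (metis digit_sum_0 less_irrefl)
  moreover have "j \<noteq> s" "j \<le> s"
    using assms(1,3) bin_neq_0_imp_le by auto
  moreover have "[j = b] (mod (p - 1))"
    using cong_trans[OF cong_sym[OF digit_sum_cong] assms(5)] .
  ultimately show ?thesis
    using assms(4) p_gt_1 by (auto simp: exponents_def corners_def)
qed

lemma s_add_p: "s + p = s0 + p * (s1 + 1 + p * q)"
  by (subst s_digits) (simp add: algebra_simps)

lemma s_add_p_carry:
  assumes "s1 = p - 1"
  shows "s + p = s0 + p * (0 + p * (q + 1))"
proof -
  have "s1 + 1 = p"
    using assms p_gt_1 by simp
  thus ?thesis
    unfolding s_add_p by simp
qed

section \<open>Adding p to s without a carry\<close>

text \<open>
  With \<open>N = n - A\<close>, the recurrences for neighbouring binomial coefficients turn the equation into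
  \<open>(N + 1) (A + 1) = N A\<close>, that is \<open>n + 1 = 0\<close> in the field.
\<close>

lemma consecutive_binomials_not_geometric:
  assumes "n + 1 < p" "0 < A" "A < n"
  shows "bin n A * bin n A \<noteq> bin n (A - 1) * bin n (A + 1)"
proof
  define N where "N = n - A"
  obtain A' where A': "A = Suc A'"
    using assms by (cases A) auto
  have rec: "of_nat (Suc k) * bin n (Suc k) = of_nat (n - k) * bin n k" for k
  proof -
    have "Suc k * (n choose Suc k) = (n - k) * (n choose k)"
      by (simp only: binomial_absorption binomial_absorb_comp)
    thus ?thesis
      unfolding bin_def by (metis of_nat_mult)
  qed
  have up: "(of_nat N + 1) * bin n (A - 1) = of_nat A * bin n A"
  proof -
    have "n - A' = Suc N"
      using assms A' by (simp add: N_def)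
    thus ?thesis
      using rec[of A'] A' by (simp add: add.commute)
  qed
  have down: "(of_nat A + 1) * bin n (A + 1) = of_nat N * bin n A"
    using rec[of A] by (simp add: N_def add.commute)
  assume eq: "bin n A * bin n A = bin n (A - 1) * bin n (A + 1)"
  have "((of_nat N + 1) * (of_nat A + 1)) * (bin n A * bin n A) =
      ((of_nat N + 1) * bin n (A - 1)) * ((of_nat A + 1) * bin n (A + 1))"
    unfolding eq by (simp only: mult_ac)
  also have "\<dots> = (of_nat A * of_nat N) * (bin n A * bin n A)"
    unfolding up down by (simp only: mult_ac)
  finally have "(of_nat N + of_nat A + 1) * (bin n A * bin n A) = 0"
    by (simp add: algebra_simps)
  moreover have "of_nat N + of_nat A + 1 = (of_nat (n + 1) :: 'k)"
    using assms by (simp add: N_def of_nat_diff)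
  moreover have "of_nat (n + 1) \<noteq> (0 :: 'k)"
    unfolding of_nat_k_eq_0_iff using assms by (auto dest: dvd_imp_le)
  moreover have "bin n A \<noteq> 0"
    using assms by (intro bin_small_neq_0) auto
  ultimately show False
    by simp
qed

text \<open>
  Let \<open>\<sigma>\<close> be the digit sum of the given exponent. If \<open>\<sigma>\<close> can be distributed over the digits
  of \<open>s\<close> other than \<open>s1\<close>, there is an exponent in the class with digit \<open>0\<close> at \<open>p\<close>. Subtracting \<open>p\<close> from it
  produces the digit \<open>p - 1 > s1\<close>, so the second coefficient vanishes there and the first does not.
  Otherwise \<open>\<sigma>\<close> leaves a digit \<open>A < s1\<close> when all the other digits are those of \<open>s\<close>. Moving one unit from
  a higher digit to the digit \<open>A\<close> gives a second exponent in the class; the two relations say that \<open>C(s1, A - 1)\<close>,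
  \<open>C(s1, A)\<close>, \<open>C(s1, A + 1)\<close> is a geometric progression.
\<close>

lemma first_coefficient_eq_0:
  assumes s1: "s1 + 1 < p"
    and rel: "\<And>j. j \<in> exponents c \<Longrightarrow> x * bin s j + y * shifted_bin j = 0"
    and j: "0 < j" "j < s" "[j = c] (mod (p - 1))" "bin s j \<noteq> 0"
  shows "x = 0"
proof (rule ccontr)
  assume x: "x \<noteq> 0"
  define \<sigma> where "\<sigma> = digit_sum p j"
  have \<sigma>_cong: "[\<sigma> = c] (mod (p - 1))"
    using cong_trans[OF digit_sum_cong j(3)] by (simp add: \<sigma>_def)
  have \<sigma>: "0 < \<sigma>" "\<sigma> < digit_sum p s"
    using digit_sum_add_of_bin_neq_0[OF j(4)] digit_sum_eq_0_iff[of j] digit_sum_eq_0_iff[of "s - j"] j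
    by (auto simp: \<sigma>_def)
  show False
  proof (cases "\<sigma> \<le> s0 + digit_sum p q")
    case True
    hence "\<sigma> \<le> digit_sum p (s0 + p * q)"
      by (simp add: digit_sum_step)
    then obtain i where i: "bin (s0 + p * q) i \<noteq> 0" "digit_sum p i = \<sigma>"
      using ex_bin_neq_0_digit_sum by blast
    define i0 i2 where "i0 = i mod p" and "i2 = i div p"
    have i_eq: "i = i0 + p * i2" "i0 < p"
      using p_gt_1 by (simp_all add: i0_def i2_def)
    define j' where "j' = i0 + p * (0 + p * i2)"
    have nz: "bin s j' \<noteq> 0"
    proof -
      have "bin s j' = bin s0 i0 * (bin s1 0 * bin q i2)"
        unfolding j'_def using i_eq(2) p_gt_1 by (intro bin_s) auto
      thus ?thesis
        using i(1) i_eq(2) by (simp add: i_eq(1) lucas_step)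
    qed
    have ds: "digit_sum p j' = \<sigma>"
    proof -
      have "digit_sum p j' = i0 + (0 + digit_sum p i2)"
        unfolding j'_def using i_eq(2) p_gt_1 by (intro digit_sum_3) auto
      thus ?thesis
        using i(2) i_eq(2) by (simp add: i_eq(1) digit_sum_step)
    qed
    have "j' div p mod p = 0"
      using i_eq(2) p_gt_1 by (simp add: j'_def)
    moreover have "p div p mod p = 1"
      using p_gt_1 by simp
    ultimately have "j' \<noteq> p"
      by auto
    hence "j' \<in> exponents c"
      using nz ds \<sigma> \<sigma>_cong by (intro in_exponentsI) auto
    moreover have "shifted_bin j' = 0"
    proof (cases i2)
      case 0
      thus ?thesis using i_eq by (simp add: j'_def shifted_bin_def)
    next
      case (Suc i')
      have "p * i2 = (p - 1) + p * i' + 1"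
        using p_gt_1 by (simp add: Suc)
      hence "j' = (i0 + p * ((p - 1) + p * i')) + p"
        by (simp only: j'_def add_0 add_mult_distrib2 mult_1_right add.assoc)
      moreover have "bin s1 (p - 1) = 0"
        using s1 by (intro bin_eq_0) auto
      ultimately show ?thesis
        using i_eq(2) p_gt_1 by (simp only: shifted_bin_add bin_s) simp
    qed
    ultimately show False
      using rel nz x by fastforce
  next
    case False
    \<comment> \<open>The digit at \<open>p\<close> that completes the other digits of \<open>s\<close> to the digit sum \<open>\<sigma>\<close>.\<close>
    define A where "A = s1 - (digit_sum p s - \<sigma>)"
    have A: "0 < A" "A < s1" "\<sigma> = s0 + (A + digit_sum p q)"
      using False \<sigma> by (auto simp: A_def digit_sum_s)
    have "digit_sum p q > 0"
      using q_ge digit_sum_eq_0_iff[of q] by simp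
    then obtain i where i: "bin q i \<noteq> 0" "digit_sum p i = digit_sum p q - 1"
      using ex_bin_neq_0_digit_sum[of "digit_sum p q - 1" q] by auto
    define j1 j2 where "j1 = s0 + p * (A + p * q)" and "j2 = s0 + p * (A + 1 + p * i)"
    have small: "A < p" "A + 1 < p" "A - 1 < p"
      using A s1 by auto
    have bins: "bin s1 A \<noteq> 0" "bin s1 (A - 1) \<noteq> 0" "bin s1 (A + 1) \<noteq> 0"
      by (rule bin_small_neq_0[OF s1_less], use A in simp)+
    have "p * 1 \<le> p * q"
      using q_ge by (intro mult_le_mono2) simp
    hence "p * 1 < p * (p * q)"
      using p_gt_1 by (intro mult_strict_left_mono) linarith+
    hence "p < j1"
      unfolding j1_def distrib_left by linarith
    hence "j1 \<noteq> p"
      by simp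
    moreover have "bin s j1 \<noteq> 0"
      unfolding j1_def using small bins by (subst bin_s) auto
    moreover have "digit_sum p j1 = \<sigma>"
      unfolding j1_def using small A by (subst digit_sum_3) auto
    ultimately have "j1 \<in> exponents c"
      using \<sigma> \<sigma>_cong by (intro in_exponentsI) auto
    moreover have "bin s j1 = bin s1 A"
      unfolding j1_def using small by (subst bin_s) auto
    moreover have "shifted_bin j1 = bin s1 (A - 1)"
    proof -
      have "j1 = (s0 + p * ((A - 1) + p * q)) + p"
        using A by (cases A) (simp_all add: j1_def)
      thus ?thesis
        using small by (simp only: shifted_bin_add bin_s s0_less bin_refl mult_1_left mult_1_right)
    qed
    ultimately have eq1: "x * bin s1 A = - (y * bin s1 (A - 1))"
      using rel by (metis add_eq_0_iff2)
    have "j2 div p mod p = A + 1"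
      unfolding j2_def using small by (intro second_digit) simp_all
    moreover have "p div p mod p = 1"
      using p_gt_1 by simp
    ultimately have "j2 \<noteq> p"
      using A by auto
    moreover have "bin s j2 \<noteq> 0"
      unfolding j2_def using small bins i by (subst bin_s) auto
    moreover have "digit_sum p j2 = \<sigma>"
      unfolding j2_def using small A i \<open>digit_sum p q > 0\<close> by (subst digit_sum_3) auto
    ultimately have "j2 \<in> exponents c"
      using \<sigma> \<sigma>_cong by (intro in_exponentsI) auto
    moreover have "bin s j2 = bin s1 (A + 1) * bin q i"
      unfolding j2_def using small by (subst bin_s) auto
    moreover have "shifted_bin j2 = bin s1 A * bin q i"
    proof -
      have "j2 = (s0 + p * (A + p * i)) + p"
        by (simp add: j2_def algebra_simps)
      thus ?thesis
        using small by (simp only: shifted_bin_add bin_s s0_less bin_refl mult_1_left)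
    qed
    ultimately have "(x * bin s1 (A + 1) + y * bin s1 A) * bin q i = 0"
      using rel[of j2] by (simp add: algebra_simps)
    hence "x * bin s1 (A + 1) + y * bin s1 A = 0"
      using i by simp
    hence eq2: "y * bin s1 A = - (x * bin s1 (A + 1))"
      by (simp only: add_eq_0_iff)
    have y: "y \<noteq> 0"
      using eq1 x bins by auto
    have "(x * y) * (bin s1 A * bin s1 A) = (x * bin s1 A) * (y * bin s1 A)"
      by (simp only: mult_ac)
    also have "\<dots> = (x * y) * (bin s1 (A - 1) * bin s1 (A + 1))"
      unfolding eq1 eq2 by (simp only: minus_mult_minus mult_ac)
    finally have "bin s1 A * bin s1 A = bin s1 (A - 1) * bin s1 (A + 1)"
      using x y by simp
    thus False
      using consecutive_binomials_not_geometric[of s1 A] s1 A by simp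
  qed
qed

text \<open>
  The reflection \<open>j \<mapsto> s + p - j\<close> exchanges \<open>C(s, j)\<close> and \<open>C(s, j - p)\<close>, so the vanishing of the
  second coefficient of a relation follows from that of the first. The classes of the second
  vectors are those of \<open>s\<close> shifted by \<open>p\<close>, which modulo \<open>p - 1\<close> means by \<open>1\<close>.
\<close>

lemma dim_no_carry:
  assumes s1: "s1 + 1 < p"
  shows "poly_XY.dim (poly_XY.span (power_products s)) = 4 + 2 * min (p - 1) (digit_sum p s - 1)"
proof -
  define next_residue where "next_residue b = (if b = p - 1 then 1 else b + 1)" for b
  define T where "T = next_residue ` residues s"
  have res: "residues s \<subseteq> {1..p-1}"
    by (auto simp: residues_def)
  have next_cong: "[i + p = next_residue b] (mod (p - 1))" if "[i = b] (mod (p - 1))" for i b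
  proof -
    have period: "[m + (p - 1) = m] (mod (p - 1))" for m
      by (simp add: cong_def)
    have "i + p = i + 1 + (p - 1)"
      using p_gt_1 by simp
    hence "[i + p = i + 1] (mod (p - 1))"
      using period[of "i + 1"] by (rule ssubst)
    also have "[i + 1 = b + 1] (mod (p - 1))"
      using that by (intro cong_add cong_refl)
    also have "[b + 1 = next_residue b] (mod (p - 1))"
    proof (cases "b = p - 1")
      case True
      hence "b + 1 = next_residue b + (p - 1)"
        by (simp add: next_residue_def)
      thus ?thesis
        using period[of "next_residue b"] by (rule ssubst)
    qed (simp add: next_residue_def)
    finally show ?thesis .
  qed
  have "inj_on next_residue {1..p-1}"
  proof (rule inj_onI)
    fix x y assume "x \<in> {1..p-1}" "y \<in> {1..p-1}" "next_residue x = next_residue y"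
    thus "x = y"
      by (cases "x = p - 1"; cases "y = p - 1") (simp_all add: next_residue_def)
  qed
  hence card_T: "card T = card (residues s)"
    unfolding T_def by (intro card_image inj_on_subset[OF _ res])
  have T: "T \<subseteq> {1..p-1}"
  proof
    fix c assume "c \<in> T"
    then obtain b where "c = next_residue b" "b \<in> {1..p-1}"
      using res unfolding T_def by blast
    thus "c \<in> {1..p-1}"
      using p_gt_1 by (cases "b = p - 1") (simp_all add: next_residue_def)
  qed
  have "poly_XY.dim (poly_XY.span (power_products s)) = 4 + card (residues s) + card T"
  proof (rule dim_module_eq[where \<epsilon> = 0 and g = shifted_bin])
    fix b j assume b: "b \<in> {1..p-1} - residues s" and j: "j \<in> exponents b"
    have j': "0 < j" "j \<noteq> s" "[j = b] (mod (p - 1))"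
      using exponents_pos[OF j] j by (simp_all add: exponents_def corners_def)
    show "bin s j = 0"
    proof (cases "j < s")
      case True
      thus ?thesis
        using b j' unfolding residues_def by blast
    next
      case False
      thus ?thesis
        using j'(2) by (intro bin_eq_0) simp
    qed
  next
    fix b j assume b: "b \<in> {1..p-1} - T" and j: "j \<in> exponents b"
    show "shifted_bin j = 0"
    proof (rule ccontr)
      assume nz: "shifted_bin j \<noteq> 0"
      define i where "i = j - p"
      have "p \<le> j"
        using nz by (auto simp: shifted_bin_def split: if_splits)
      hence ji: "j = i + p"
        by (simp add: i_def)
      have i: "bin s i \<noteq> 0" "0 < i" "i < s"
        using nz j by (auto simp: ji shifted_bin_add exponents_def corners_def)
      obtain b' where b': "b' \<in> {1..p-1}" "[i = b'] (mod (p - 1))"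
        using ex_positive_residue by blast
      hence "b' \<in> residues s"
        using i by (auto simp: residues_def)
      hence T': "next_residue b' \<in> T"
        by (simp add: T_def)
      have "j \<in> exponents (next_residue b')"
        using j next_cong[OF b'(2)] by (simp add: exponents_def ji)
      hence "b = next_residue b'"
        using exponents_unique[OF j] b T T' by blast
      thus False
        using b T' by simp
    qed
  next
    fix b x y assume b: "b \<in> {1..p-1}"
      and rel: "\<And>j. j \<in> exponents b \<Longrightarrow> x * bin s j + y * shifted_bin j = 0"
    have "x = 0" if b': "b \<in> residues s"
    proof -
      obtain j where "0 < j" "j < s" "[j = b] (mod (p - 1))" "bin s j \<noteq> 0"
        using b' by (auto simp: residues_def)
      from first_coefficient_eq_0[OF s1 rel this] show ?thesis .
    qed
    moreover have "y = 0" if b': "b \<in> T"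
    proof -
      obtain b'' where b'': "b = next_residue b''" "b'' \<in> residues s"
        using b' unfolding T_def by blast
      obtain i where i: "0 < i" "i < s" "[i = b''] (mod (p - 1))" "bin s i \<noteq> 0"
        using b''(2) unfolding residues_def by blast
      have i_cong: "[i + p = b] (mod (p - 1))"
        unfolding b''(1) using i(3) by (rule next_cong)
      have b_le: "b \<le> s + p"
        using b by auto
      \<comment> \<open>The reflected relation, with \<open>x\<close> and \<open>y\<close> exchanged.\<close>
      have mirrored: "y * bin s j + x * shifted_bin j = 0" if j: "j \<in> exponents (s + p - b)" for j
      proof -
        have j': "j \<le> s + p" "j \<notin> corners" "[j = s + p - b] (mod (p - 1))"
          using j by (auto simp: exponents_def)
        have "[j + b = s + p - b + b] (mod (p - 1))"
          using j'(3) by (intro cong_add cong_refl)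
        moreover have "s + p - b + b = j + (s + p - j)"
          using b_le j'(1) by simp
        ultimately have "[j + b = j + (s + p - j)] (mod (p - 1))"
          by simp
        hence "[b = s + p - j] (mod (p - 1))"
          by (simp only: cong_add_lcancel_nat)
        hence "[s + p - j = b] (mod (p - 1))"
          by (rule cong_sym)
        hence "s + p - j \<in> exponents b"
          using j' by (auto simp: exponents_def corners_def)
        hence "x * bin s (s + p - j) + y * shifted_bin (s + p - j) = 0"
          by (rule rel)
        moreover have "bin s (s + p - j) = shifted_bin j"
        proof (cases "p \<le> j")
          case True
          hence eq: "s + p - j = s - (j - p)" "j - p \<le> s"
            using j'(1) by auto
          show ?thesis
            unfolding eq(1) bin_symmetric[OF eq(2)] using True by (simp add: shifted_bin_def)
        next
          case False
          thus ?thesis by (simp add: shifted_bin_def bin_eq_0)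
        qed
        moreover have "shifted_bin (s + p - j) = bin s j"
        proof (cases "j \<le> s")
          case True
          hence "s + p - j = (s - j) + p"
            by simp
          thus ?thesis
            using True by (simp only: shifted_bin_add bin_symmetric)
        next
          case False
          thus ?thesis using j'(1) by (simp add: shifted_bin_def bin_eq_0)
        qed
        ultimately show ?thesis
          by (simp add: add.commute)
      qed
      have "[s - i = s + p - b] (mod (p - 1))"
      proof -
        have "(s - i) + (i + p) = (s + p - b) + b"
          using i b_le by simp
        moreover have "[(s - i) + (i + p) = (s - i) + b] (mod (p - 1))"
          using i_cong by (intro cong_add cong_refl)
        ultimately have "[(s + p - b) + b = (s - i) + b] (mod (p - 1))"
          by simp
        hence "[s + p - b = s - i] (mod (p - 1))"
          by (simp only: cong_add_rcancel_nat)
        thus ?thesis by (rule cong_sym)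
      qed
      moreover have "0 < s - i" "s - i < s" "bin s (s - i) \<noteq> 0"
        using i by (auto simp: bin_symmetric)
      ultimately show ?thesis
        by (intro first_coefficient_eq_0[OF s1 mirrored])
    qed
    ultimately show "(b \<in> residues s \<longrightarrow> x = 0) \<and> (b \<in> T \<longrightarrow> y = 0)"
      by blast
  qed (use res T in auto)
  thus ?thesis
    by (simp add: card_T card_residues)
qed

section \<open>Adding p to s with a carry\<close>

text \<open>
  After the carry, \<open>s + p\<close> has digit \<open>0\<close> at \<open>p\<close>; therefore \<open>C(s + p, j)\<close> vanishes whenever the
  digit \<open>j1\<close> of \<open>j\<close> is nonzero, while \<open>C(s, j)\<close> does not constrain \<open>j1\<close> at all.
\<close>

lemma bin_sum_digit:
  assumes s1: "s1 = p - 1" and "j0 < p" "j1 < p"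
  shows "bin (s + p) (j0 + p * (j1 + p * j2)) = bin s0 j0 * (bin 0 j1 * bin (q + 1) j2)"
proof -
  have "0 < p"
    using p_gt_1 by simp
  show ?thesis
    unfolding s_add_p_carry[OF s1] lucas_step[OF s0_less assms(2)] lucas_step[OF \<open>0 < p\<close> assms(3)]
    by (rule refl)
qed

text \<open>
  An exponent \<open>j\<close> whose digit at \<open>p\<close> is nonzero and for which \<open>C(s, j)\<close> is nonzero forces \<open>x = 0\<close>. For \<open>b > 1\<close>
  one may take \<open>j = p b\<close>. For \<open>b = 1\<close> this is the corner \<open>p\<close>; then \<open>j = 2 p^2 - p\<close> works unless the digit of
  \<open>s\<close> at \<open>p^2\<close> vanishes, and in that case \<open>j = p^2\<close> and a suitable higher power of \<open>p\<close> give two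
  relations from which \<open>y = 0\<close> and \<open>x = 0\<close> follow.
\<close>

lemma coefficients_eq_0_carry:
  assumes s1: "s1 = p - 1" and b: "b \<in> {1..p-1}"
    and rel: "\<And>j. j \<in> exponents b \<Longrightarrow> x * bin s j + y * bin (s + p) j = 0"
  shows "x = 0 \<and> (b \<in> residues (s + p) \<longrightarrow> y = 0)"
proof -
  have x_eq_0: "x = 0" if "j0 < p" "j1 < p" "j1 > 0" "bin s (j0 + p * (j1 + p * j2)) \<noteq> 0"
    "j0 + p * (j1 + p * j2) \<in> exponents b" for j0 j1 j2
    using rel[OF that(5)] bin_sum_digit[OF s1 that(1,2), of j2] that bin_eq_0[of 0 j1] by simp
  have s_big: "p * p + p * p \<le> s"
    using s_ge by (simp only: power2_eq_square)
  have pp: "p < p * p"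
    using p_gt_1 by simp
  have "x = 0"
  proof (cases "b = 1")
    case False
    have "p * b \<le> p * (p - 1)"
      using b by (intro mult_le_mono) auto
    hence "p * b < s"
      using s_gt(1) by linarith
    moreover have "p * b \<noteq> 0" "p * b \<noteq> p"
      using b False p_gt_1 by auto
    moreover have "[p * b = b] (mod (p - 1))"
      using cong_trans[OF cong_sym[OF digit_sum_cong[of "p * b"]], of b]
        digit_sum_3[of 0 b 0] b p_gt_1 by force
    ultimately have "p * b \<in> exponents b"
      by (simp add: exponents_def corners_def)
    moreover have "bin s (0 + p * (b + p * 0)) \<noteq> 0"
    proof -
      have "b < p" "b \<le> s1" "0 < p"
        using b p_gt_1 s1 by auto
      thus ?thesis
        using bin_small_neq_0[of s1 b] by (simp only: bin_s s1_less) simp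
    qed
    ultimately show ?thesis
      using x_eq_0[of 0 b 0] b p_gt_1 by auto
  next
    case b1: True
    show ?thesis
    proof (cases "of_nat q = (0::'k)")
      case False
      define j where "j = 0 + p * ((p - 1) + p * 1)"
      have j_eq: "j = p * (p - 1) + p * p"
        by (simp add: j_def algebra_simps)
      have "p * (p - 1) < p * p"
        using p_gt_1 by simp
      hence "j < s" "j > p"
        using s_big pp unfolding j_eq by linarith+
      moreover have "[j = b] (mod (p - 1))"
      proof -
        have "digit_sum p j = 0 + ((p - 1) + digit_sum p 1)"
          unfolding j_def using p_gt_1 by (intro digit_sum_3) auto
        also have "digit_sum p 1 = 1"
          using digit_sum_step[of 1 0] p_gt_1 by simp
        finally have "digit_sum p j = 1 + (p - 1)"
          by simp
        hence "[digit_sum p j = 1] (mod (p - 1))"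
          by (simp only: cong_def mod_add_self2)
        thus ?thesis
          using cong_trans[OF cong_sym[OF digit_sum_cong]] b1 by blast
      qed
      ultimately have "j \<in> exponents b"
        by (auto simp: exponents_def corners_def)
      moreover have "bin s j \<noteq> 0"
        unfolding j_def using p_gt_1 s1 False by (subst bin_s) (auto simp: bin_1_right)
      ultimately show ?thesis
        using x_eq_0[of 0 "p - 1" 1] p_gt_1 by (auto simp: j_def)
    next
      case True
      have power_cong: "[0 + p * (0 + p * i) = 1] (mod (p - 1))" if "digit_sum p i = 1" for i
        using digit_sum_cong[of "0 + p * (0 + p * i)"] digit_sum_3[of 0 0 i] p_gt_1 that
        by (simp add: cong_sym_eq)
      define j where "j = 0 + p * (0 + p * 1)"
      have "j = p * p"
        by (simp add: j_def)
      hence "j < s" "j > p"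
        using s_big pp p_gt_1 by linarith+
      moreover have "[j = b] (mod (p - 1))"
        unfolding j_def b1 using digit_sum_step[of 1 0] p_gt_1 by (intro power_cong) simp
      ultimately have "j \<in> exponents b"
        by (auto simp: exponents_def corners_def)
      moreover have "bin s j = 0"
        unfolding j_def using p_gt_1 True by (subst bin_s) (auto simp: bin_1_right)
      moreover have "bin (s + p) j = 1"
        unfolding j_def using p_gt_1 True s1 by (subst bin_sum_digit) (auto simp: bin_1_right)
      ultimately have y: "y = 0"
        using rel[of j] by simp
      have "digit_sum p q > 0"
        using q_ge digit_sum_eq_0_iff[of q] by simp
      then obtain i where i: "bin q i \<noteq> 0" "digit_sum p i = 1"
        using ex_bin_neq_0_digit_sum[of 1 q] by auto
      define j' where "j' = 0 + p * (0 + p * i)"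
      have nz: "bin s j' \<noteq> 0"
        unfolding j'_def using p_gt_1 i by (subst bin_s) auto
      have "j' div p mod p = 0"
        using p_gt_1 by (simp add: j'_def)
      moreover have "p div p mod p = 1" "s div p mod p = p - 1"
        using p_gt_1 s1 by (simp_all add: s1_def)
      ultimately have "j' \<noteq> p" "j' \<noteq> s"
        using p_gt_1 by auto
      moreover have "j' \<noteq> 0"
        using i p_gt_1 by (cases "i = 0") (auto simp: j'_def)
      moreover have "j' \<le> s"
        using nz by (rule bin_neq_0_imp_le)
      moreover have "[j' = b] (mod (p - 1))"
        unfolding j'_def b1 using i(2) by (rule power_cong)
      ultimately have "j' \<in> exponents b"
        using p_gt_1 by (auto simp: exponents_def corners_def)
      thus ?thesis
        using rel[of j'] nz y by simp
    qed
  qed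
  moreover have "y = 0" if b': "b \<in> residues (s + p)"
  proof -
    obtain j where j: "0 < j" "j < s + p" "[j = b] (mod (p - 1))" "bin (s + p) j \<noteq> 0"
      using b' unfolding residues_def by blast
    have "bin (s + p) p = 0"
      using bin_sum_digit[OF s1, of 0 1 0] p_gt_1 bin_eq_0[of 0 1] by simp
    moreover from this have "bin (s + p) s = 0"
      using bin_symmetric[of p "s + p"] by simp
    ultimately have "j \<in> exponents b"
      using j by (auto simp: exponents_def corners_def)
    thus ?thesis
      using rel[of j] j(4) \<open>x = 0\<close> by simp
  qed
  ultimately show ?thesis
    by blast
qed

lemma dim_carry:
  assumes s1: "s1 = p - 1"
  shows "poly_XY.dim (poly_XY.span (power_products s)) =
    4 + (p - 1) + min (p - 1) (digit_sum p (s + p) - 1)"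
proof -
  have "poly_XY.dim (poly_XY.span (power_products s)) = 4 + card {1..p-1} + card (residues (s + p))"
  proof (rule dim_module_eq[where \<epsilon> = 1 and g = "bin (s + p)"])
    fix b j assume "b \<in> {1..p-1} - residues (s + p)" "j \<in> exponents b"
    moreover from this have "0 < j" "j < s + p" "[j = b] (mod (p - 1))"
      using exponents_pos[of j b] by (simp_all add: exponents_def corners_def)
    ultimately show "bin (s + p) j = 0"
      unfolding residues_def by blast
  next
    fix b x y assume "b \<in> {1..p-1}"
      and "\<And>j. j \<in> exponents b \<Longrightarrow> x * bin s j + y * bin (s + p) j = 0"
    from coefficients_eq_0_carry[OF s1 this]
    show "(b \<in> {1..p-1} \<longrightarrow> x = 0) \<and> (b \<in> residues (s + p) \<longrightarrow> y = 0)"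
      by blast
  qed (auto simp: bin_s_add_p residues_def)
  thus ?thesis
    by (simp add: card_residues)
qed

section \<open>Detecting the carry by digit sums\<close>

lemma digit_sum_no_carry: "s1 + 1 < p \<Longrightarrow> digit_sum p (s + p) = digit_sum p s + 1"
proof -
  assume "s1 + 1 < p"
  thus ?thesis
    unfolding s_add_p using digit_sum_3[OF s0_less, of "s1 + 1" q] by (simp add: digit_sum_s)
qed

text \<open>
  Let \<open>s0\<close> be the last digit of \<open>s\<close>. With a carry, \<open>p ^ 2\<close> divides \<open>s + p\<close> if \<open>s0 = 0\<close>, and otherwise
  subtracting \<open>p\<close> creates a digit \<open>p - 1\<close> while subtracting \<open>1\<close> only lowers \<open>s0\<close>. Without a
  carry, \<open>s + p\<close> has a nonzero digit at \<open>p\<close>, so \<open>p ^ 2\<close> does not divide it, and subtracting \<open>p\<close> lowers the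
  digit sum by \<open>1\<close>, which is the most that subtracting \<open>1\<close> can do.
\<close>

lemma carry_iff:
  assumes r: "s + p = p ^ n * u" and u: "\<not> p dvd u"
  shows "n \<ge> 2 \<or> digit_sum p s > digit_sum p (s + p - 1) \<longleftrightarrow> s1 = p - 1"
proof (cases "s1 + 1 < p")
  case True
  note sp = s_add_p
  have "(s + p) div p mod p = s1 + 1"
    unfolding sp by (rule second_digit) (use True in auto)
  moreover have "(s + p) div p mod p = 0" if n: "n \<ge> 2"
  proof -
    obtain k where "n = Suc (Suc k)"
      using n by (metis add_2_eq_Suc le_iff_add)
    hence "s + p = p * (p * (p ^ k * u))"
      by (simp add: r)
    thus ?thesis
      using p_gt_1 by simp
  qed
  moreover have "digit_sum p s \<le> digit_sum p (s + p - 1)"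
  proof (cases "s0 = 0")
    case True
    hence "s + p - 1 = (p - 1) + p * (s1 + p * q)"
      using sp p_gt_1 by (simp add: algebra_simps)
    hence "digit_sum p (s + p - 1) = (p - 1) + (s1 + digit_sum p q)"
      using p_gt_1 digit_sum_3[of "p - 1" s1 q] by simp
    thus ?thesis
      using True by (simp add: digit_sum_s)
  next
    case False
    hence "s + p - 1 = (s0 - 1) + p * (s1 + 1 + p * q)"
      unfolding sp by simp
    moreover have "s0 - 1 < p"
      using s0_less by linarith
    ultimately have "digit_sum p (s + p - 1) = (s0 - 1) + (s1 + 1 + digit_sum p q)"
      using True by (simp only: digit_sum_3)
    thus ?thesis
      using False by (simp add: digit_sum_s)
  qed
  ultimately show ?thesis
    using True by auto
next
  case False
  hence s1: "s1 = p - 1"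
    using s1_less by linarith
  note sp = s_add_p_carry[OF s1]
  have "n \<ge> 2" if "s0 = 0"
  proof (rule ccontr)
    assume "\<not> n \<ge> 2"
    moreover have dvd: "p * p dvd p ^ n * u"
      using sp that by (simp flip: r)
    ultimately have "n = 0 \<or> n = 1" by auto
    thus False
      using u dvd p_gt_1 by (auto dest: dvd_mult_left)
  qed
  moreover have "digit_sum p s > digit_sum p (s + p - 1)" if "s0 \<noteq> 0"
  proof -
    have "s + p - 1 = (s0 - 1) + p * (0 + p * (q + 1))"
      unfolding sp using that by simp
    moreover have "s0 - 1 < p" "0 < p"
      using s0_less by linarith+
    ultimately have "digit_sum p (s + p - 1) = (s0 - 1) + (0 + digit_sum p (q + 1))"
      by (simp only: digit_sum_3)
    also have "\<dots> \<le> (s0 - 1) + (digit_sum p q + 1)"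
      using digit_sum_Suc_le[of q] by simp
    also have "\<dots> < digit_sum p s"
      using that p_gt_1 by (simp add: digit_sum_s s1)
    finally show ?thesis .
  qed
  ultimately show ?thesis
    using s1 by blast
qed

end

theorem corollary1p5:
  fixes p r n u \<delta> :: nat
  assumes "prime p" and "p \<ge> 3" and "CARD('k::field) = p"
    and "r \<ge> p * (2 * p + 1)"
    and "r = p ^ n * u" and "\<not> p dvd u"
    and "\<delta> = (if n \<ge> 2 \<or> digit_sum p (r - p) > digit_sum p (r - 1) then 1 else 0)"
  shows "poly_XY.dim (generated_submodule r (varX ^ (r - p) * varY ^ p) :: 'k poly poly set) =
    (if digit_sum p r \<le> p
     then 2 * digit_sum p r + \<delta> * (p + 2 - digit_sum p r)
     else 2 * p + 2)"
proof -
  define s where "s = r - p"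
  have "2 * p\<^sup>2 + p \<le> r"
    using assms(4) by (simp add: power2_eq_square algebra_simps)
  hence s: "2 * p\<^sup>2 \<le> s" "s + p = r"
    by (simp_all add: s_def)
  interpret monomial_module p "TYPE('k)" s
    by unfold_locales (use assms s in auto)
  have dim: "poly_XY.dim (generated_submodule r (varX ^ (r - p) * varY ^ p) :: 'k poly poly set) =
      poly_XY.dim (poly_XY.span (power_products s))"
    using generated_submodule_eq_span[OF s_gt(3)] by (simp only: s(2) flip: s_def)
  have \<delta>: "\<delta> = (if s1 = p - 1 then 1 else 0)"
    using carry_iff[of n u] assms(5-7) s by (simp add: s_def)
  have "digit_sum p s > 0" "digit_sum p r > 0"
    using digit_sum_eq_0_iff[of s] digit_sum_eq_0_iff[of r] s_gt s by auto
  show ?thesis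
  proof (cases "s1 + 1 < p")
    case True
    have "digit_sum p r = digit_sum p s + 1"
      using digit_sum_no_carry[OF True] by (simp add: s)
    thus ?thesis
      unfolding dim dim_no_carry[OF True] using True \<open>digit_sum p s > 0\<close> \<delta> p_gt_1
      by (auto simp: min_def)
  next
    case False
    hence "s1 = p - 1"
      using s1_less by linarith
    thus ?thesis
      unfolding dim dim_carry[OF \<open>s1 = p - 1\<close>] s(2) using \<delta> p_gt_1 \<open>digit_sum p r > 0\<close>
      by (auto simp: min_def)
  qed
qed

end
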